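(* Let $S_0$ be the open unit disk, the complex plane or the Riemann sphere, let $f:S_0\to S_0$ be a holomorphic branched covering of degree $d$ with $1<d<\infty$, let $S_\infty$ be its plaque inverse limit, and let $c$ be a critical point of $f$. For a point $x=(x_1,x_2,\dots)\in S_\infty$, the signature $sign(x,c)$ can be greater than (strictly contain) $\{[0,0,\dots]\}$ only if all $x_i$ are contained in $\Gamma(c)$. Vice versa, for any $x_1\in\Gamma(c)$ one can, starting with this $x_1$, construct a point $x=(x_1,x_2,\dots)\in S_\infty$ such that $sign(x,c)$ is greater than $\{[0,0,\dots]\}$. In other words, the invariant lift of $\Gamma(c)$ to $S_\infty$ is the set of all irregular points $x\in S_\infty$ such that $sign(x,c)$ is not trivial (i.e. $sign(x,c)\neq\{[0,0,\dots]\}$).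
   Context: Put $S_1=S_2=\dots=S_0$ and $f_i=f:S_{i+1}\to S_i$. The plaque inverse limit $S_\infty$ is the set of all sequences $x=(x_1,x_2,\dots)$ with $x_i\in S_i$ and $f(x_{i+1})=x_i$ for all $i$, with the topology generated by the sets given by sequences $U=(U_1,U_2,\dots)$ of open sets $U_i\subset S_i$ with $f(U_{i+1})=U_i$ for all $i$ (such a $U$ being identified with the set of $x\in S_\infty$ with $x_i\in U_i$ for all $i$). A plaque is such an open set $U$ in which each $U_i$ is conformally equivalent to the unit disk and each $f|_{U_{i+1}}:U_{i+1}\to U_i$ is conformally equivalent to a self-map $z\mapsto z^t$ of the unit disk, $1\le t\le d$. Plaques containing $x$ form a local base at $x$. Convention: open neighborhoods of points of $S_\infty$ are plaques, and open neighborhoods of points in a Riemann surface are simply connected. A point $x\in S_\infty$ is regular if it has an open neighborhood $U$ such that, for some positive integer $n$, the maps $f:U_{i+1}\to U_i$ are bijections for all $i\ge n$; otherwise $x$ is irregular. Let $I$ be the Boolean algebra of binary sequences modulo almost equality (differing in only finitely many places), with coordinatewise operations and order; $[a_1,a_2,\dots]$ denotes the class of $(a_1,a_2,\dots)$. For $a\in I$ let $\alpha(a)=\{b\in I: b\le a\}$. For an open neighborhood $U\subset S_\infty$ and a critical point $c\in S_0$ of $f$, $ind(U,c)\in I$ is the class of the binary sequence with $1$ in the $n$-th place if and only if $c\in U_n$. A sequence $(U(1),U(2),\dots)$ of open neighborhoods of $x$ shrinks to $x$ if $U(i+1)\subset U(i)$ for all $i$ and every open neighborhood of $x$ contains some $U(m)$.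 The signature of $x$ with respect to $c$ is $sign(x,c)=\bigcap_{j=1}^\infty\alpha(ind(U(j),c))$ for any sequence $(U(1),U(2),\dots)$ of open neighborhoods of $x$ shrinking to $x$ (it does not depend on the choice). The $\omega$-limit set $\omega(c)$ is the set of all $x_0\in S_0$ for which there is an increasing sequence $(i_1,i_2,\dots)$ of positive integers with $f^{i_t}(c)\to x_0$ (some or all $f^{i_t}(c)$ may equal $x_0$). A subset $V\subset\omega(c)$ is inverse-critical with respect to $c$ if for every $z\in V$ and every neighborhood $U$ of $z$ there is a pre-image $y\in V$ of $z$ under some iterate $f^n$ of $f$ such that the connected component of $f^{-n}(U)$ containing $y$ also contains $c$. $\Gamma(c)$ is the union of all inverse-critical sets with respect to $c$ (the maximal inverse-critical set with respect to $c$); if it is not empty, $f(\Gamma(c))=\Gamma(c)$. The invariant lift of a set $V\subset S_0$ to $S_\infty$ is the set of all $x=(x_1,x_2,\dots)\in S_\infty$ with $x_i\in V$ for all $i$.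
   Formalization: A point in no plaque has no signature; constructed points are shown to have a nontrivial signature only if one exists. The final equality fails in general: proved instead are ⊆ and that initial segments of lift points extend in the lift to irregular points whose signature, if any, is nontrivial. *)

theory Defs
  imports "HOL-Complex_Analysis.Complex_Analysis"
begin

section \<open>The Riemann sphere\<close>

datatype riemann_sphere = Fin complex | Infty

instantiation riemann_sphere :: topological_space
begin

text \<open>The one-point compactification of the plane.\<close>

definition open_riemann_sphere :: "riemann_sphere set \<Rightarrow> bool" where
  "open U \<longleftrightarrow> open (Fin -` U) \<and> (Infty \<in> U \<longrightarrow> compact (- (Fin -` U)))"

instance
proof
  show "open (UNIV :: riemann_sphere set)"
    by (simp add: open_riemann_sphere_def)
next
  fix U V :: "riemann_sphere set"
  assume "open U" "open V"
  then show "open (U \<inter> V)"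
    by (auto simp: open_riemann_sphere_def open_Int compact_Un)
next
  fix K :: "riemann_sphere set set"
  assume K: "\<forall>U\<in>K. open U"
  have op: "open (Fin -` \<Union>K)"
    using K by (auto simp: open_riemann_sphere_def vimage_Union)
  have "compact (- (Fin -` \<Union>K))" if inf: "Infty \<in> \<Union>K"
  proof -
    obtain U where U: "U \<in> K" "Infty \<in> U" using inf by blast
    have "compact (- (Fin -` U))" using K U by (auto simp: open_riemann_sphere_def)
    moreover have "closed (- (Fin -` \<Union>K))" using op by (simp add: closed_def)
    ultimately have "compact ((- (Fin -` U)) \<inter> (- (Fin -` \<Union>K)))"
      by (rule compact_Int_closed)
    moreover have "(- (Fin -` U)) \<inter> (- (Fin -` \<Union>K)) = - (Fin -` \<Union>K)"
      using U by blast
    ultimately show ?thesis by simp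
  qed
  with op show "open (\<Union>K)" by (simp add: open_riemann_sphere_def)
qed

end

text \<open>
  A holomorphic coordinate centred at a point and its inverse parametrisation. The coordinate
  centred at \<open>Fin a\<close> is not defined at \<open>Infty\<close>, and the one centred at \<open>Infty\<close> is not defined at
  \<open>Fin 0\<close>; the values there are junk and play no role, as only germs at the centre are used.
\<close>

fun coord_at :: "riemann_sphere \<Rightarrow> riemann_sphere \<Rightarrow> complex" where
  "coord_at (Fin a) (Fin z) = z - a"
| "coord_at (Fin a) Infty = 0"
| "coord_at Infty (Fin z) = inverse z"
| "coord_at Infty Infty = 0"

fun param_at :: "riemann_sphere \<Rightarrow> complex \<Rightarrow> riemann_sphere" where
  "param_at (Fin a) h = Fin (a + h)"
| "param_at Infty h = (if h = 0 then Infty else Fin (inverse h))"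

definition local_expr :: "(riemann_sphere \<Rightarrow> riemann_sphere) \<Rightarrow> riemann_sphere \<Rightarrow> complex \<Rightarrow> complex" where
  "local_expr f p h = coord_at (f p) (f (param_at p h))"

text \<open>Used for open sets \<open>S\<close> only.\<close>

definition sphere_holomorphic_on :: "(riemann_sphere \<Rightarrow> riemann_sphere) \<Rightarrow> riemann_sphere set \<Rightarrow> bool" where
  "sphere_holomorphic_on f S \<longleftrightarrow>
     continuous_on S f \<and> (\<forall>p\<in>S. local_expr f p analytic_on {0})"

definition local_degree :: "(riemann_sphere \<Rightarrow> riemann_sphere) \<Rightarrow> riemann_sphere \<Rightarrow> nat" where
  "local_degree f p = nat (zorder (local_expr f p) 0)"

definition critical_point :: "(riemann_sphere \<Rightarrow> riemann_sphere) \<Rightarrow> riemann_sphere \<Rightarrow> bool" where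
  "critical_point f p \<longleftrightarrow> deriv (local_expr f p) 0 = 0"

definition unit_disk :: "riemann_sphere set" where
  "unit_disk = Fin ` ball 0 1"

definition complex_plane :: "riemann_sphere set" where
  "complex_plane = range Fin"

definition conformal_iso :: "riemann_sphere set \<Rightarrow> riemann_sphere set \<Rightarrow> (riemann_sphere \<Rightarrow> riemann_sphere) \<Rightarrow> bool" where
  "conformal_iso A B \<phi> \<longleftrightarrow>
     bij_betw \<phi> A B \<and> sphere_holomorphic_on \<phi> A \<and> sphere_holomorphic_on (inv_into A \<phi>) B"

text \<open>
  A finite branched covering is a proper holomorphic map all of whose fibres have
  \<open>d\<close> points, counted with multiplicity.
\<close>

definition branched_covering :: "riemann_sphere set \<Rightarrow> (riemann_sphere \<Rightarrow> riemann_sphere) \<Rightarrow> nat \<Rightarrow> bool" where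
  "branched_covering S f d \<longleftrightarrow>
     f ` S \<subseteq> S \<and> sphere_holomorphic_on f S \<and>
     (\<forall>K. compact K \<and> K \<subseteq> S \<longrightarrow> compact {p \<in> S. f p \<in> K}) \<and>
     (\<forall>q\<in>S. finite {p \<in> S. f p = q} \<and> (\<Sum>p | p \<in> S \<and> f p = q. local_degree f p) = d)"


section \<open>The plaque inverse limit\<close>

text \<open>Sequences are indexed from 0, so that \<open>x i\<close> is the coordinate written \<open>x\<^sub>i\<^sub>+\<^sub>1\<close> on paper.\<close>

definition inverse_limit :: "riemann_sphere set \<Rightarrow> (riemann_sphere \<Rightarrow> riemann_sphere) \<Rightarrow> (nat \<Rightarrow> riemann_sphere) set" where
  "inverse_limit S f = {x. \<forall>i. x i \<in> S \<and> f (x (Suc i)) = x i}"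

definition plaque :: "riemann_sphere set \<Rightarrow> (riemann_sphere \<Rightarrow> riemann_sphere) \<Rightarrow> nat \<Rightarrow> (nat \<Rightarrow> riemann_sphere set) \<Rightarrow> bool" where
  "plaque S f d U \<longleftrightarrow>
     (\<forall>i. open (U i) \<and> U i \<subseteq> S \<and> f ` U (Suc i) = U i) \<and>
     (\<forall>i. \<exists>\<phi>. conformal_iso (U i) unit_disk \<phi>) \<and>
     (\<forall>i. \<exists>t \<phi> \<psi>. 1 \<le> t \<and> t \<le> d \<and>
        conformal_iso (U (Suc i)) unit_disk \<phi> \<and> conformal_iso (U i) unit_disk \<psi> \<and>
        (\<forall>p\<in>U (Suc i). \<forall>z. \<phi> p = Fin z \<longrightarrow> \<psi> (f p) = Fin (z ^ t)))"

text \<open>The subset of the inverse limit with which the sequence \<open>U\<close> is identified.\<close>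

definition plaque_points :: "riemann_sphere set \<Rightarrow> (riemann_sphere \<Rightarrow> riemann_sphere) \<Rightarrow> (nat \<Rightarrow> riemann_sphere set) \<Rightarrow> (nat \<Rightarrow> riemann_sphere) set" where
  "plaque_points S f U = {x \<in> inverse_limit S f. \<forall>i. x i \<in> U i}"

definition regular_point :: "riemann_sphere set \<Rightarrow> (riemann_sphere \<Rightarrow> riemann_sphere) \<Rightarrow> nat \<Rightarrow> (nat \<Rightarrow> riemann_sphere) \<Rightarrow> bool" where
  "regular_point S f d x \<longleftrightarrow>
     (\<exists>U. plaque S f d U \<and> x \<in> plaque_points S f U \<and>
          (\<exists>n. \<forall>i\<ge>n. bij_betw f (U (Suc i)) (U i)))"


section \<open>Binary sequences modulo almost equality\<close>

definition almost_equal :: "(nat \<Rightarrow> bool) \<Rightarrow> (nat \<Rightarrow> bool) \<Rightarrow> bool" where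
  "almost_equal a b \<longleftrightarrow> finite {n. a n \<noteq> b n}"

lemma equivp_almost_equal: "equivp almost_equal"
proof (rule equivpI)
  show "reflp almost_equal" by (auto intro: reflpI simp: almost_equal_def)
  show "symp almost_equal" by (auto intro!: sympI simp: almost_equal_def eq_commute)
  show "transp almost_equal"
  proof (rule transpI)
    fix a b c assume "almost_equal a b" "almost_equal b c"
    then have "finite ({n. a n \<noteq> b n} \<union> {n. b n \<noteq> c n})" by (simp add: almost_equal_def)
    then show "almost_equal a c"
      unfolding almost_equal_def by (rule rev_finite_subset) auto
  qed
qed

quotient_type binary_class = "nat \<Rightarrow> bool" / almost_equal
  morphisms rep_binary_class binary_class
  by (rule equivp_almost_equal)

lemma finite_Collect_none: "(\<And>n. \<not> P n) \<Longrightarrow> finite {n. P n}"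
  by simp

instantiation binary_class :: boolean_algebra
begin

lift_definition less_eq_binary_class :: "binary_class \<Rightarrow> binary_class \<Rightarrow> bool"
  is "\<lambda>a b. finite {n. a n \<and> \<not> b n}"
proof -
  have *: "finite {n. a' n \<and> \<not> b' n}"
    if "almost_equal a a'" "almost_equal b b'" "finite {n. a n \<and> \<not> b n}" for a a' b b'
  proof -
    have "finite ({n. a n \<noteq> a' n} \<union> {n. b n \<noteq> b' n} \<union> {n. a n \<and> \<not> b n})"
      using that by (simp add: almost_equal_def)
    then show ?thesis by (rule rev_finite_subset) auto
  qed
  fix a a' b b' assume "almost_equal a a'" "almost_equal b b'"
  then show "finite {n. a n \<and> \<not> b n} = finite {n. a' n \<and> \<not> b' n}"
    using * equivp_symp[OF equivp_almost_equal] by blast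
qed

definition less_binary_class :: "binary_class \<Rightarrow> binary_class \<Rightarrow> bool" where
  "less_binary_class a b \<longleftrightarrow> a \<le> b \<and> \<not> b \<le> a"

lift_definition inf_binary_class :: "binary_class \<Rightarrow> binary_class \<Rightarrow> binary_class"
  is "\<lambda>a b n. a n \<and> b n"
  unfolding almost_equal_def
proof -
  fix a a' b b' :: "nat \<Rightarrow> bool"
  assume "finite {n. a n \<noteq> a' n}" "finite {n. b n \<noteq> b' n}"
  then have "finite ({n. a n \<noteq> a' n} \<union> {n. b n \<noteq> b' n})" by simp
  then show "finite {n. (a n \<and> b n) \<noteq> (a' n \<and> b' n)}" by (rule rev_finite_subset) auto
qed

lift_definition sup_binary_class :: "binary_class \<Rightarrow> binary_class \<Rightarrow> binary_class"
  is "\<lambda>a b n. a n \<or> b n"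
  unfolding almost_equal_def
proof -
  fix a a' b b' :: "nat \<Rightarrow> bool"
  assume "finite {n. a n \<noteq> a' n}" "finite {n. b n \<noteq> b' n}"
  then have "finite ({n. a n \<noteq> a' n} \<union> {n. b n \<noteq> b' n})" by simp
  then show "finite {n. (a n \<or> b n) \<noteq> (a' n \<or> b' n)}" by (rule rev_finite_subset) auto
qed

lift_definition uminus_binary_class :: "binary_class \<Rightarrow> binary_class"
  is "\<lambda>a n. \<not> a n"
  by (simp add: almost_equal_def)

definition minus_binary_class :: "binary_class \<Rightarrow> binary_class \<Rightarrow> binary_class" where
  "minus_binary_class a b = inf a (- b)"

lift_definition bot_binary_class :: binary_class is "\<lambda>n. False" .

lift_definition top_binary_class :: binary_class is "\<lambda>n. True" .

instance
proof
  fix a b c :: binary_class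
  show "a < b \<longleftrightarrow> a \<le> b \<and> \<not> b \<le> a" by (rule less_binary_class_def)
  show "a \<le> a" by transfer (rule finite_Collect_none, blast)
  show "a - b = inf a (- b)" by (rule minus_binary_class_def)
  show "inf a b \<le> a" by transfer (rule finite_Collect_none, blast)
  show "inf a b \<le> b" by transfer (rule finite_Collect_none, blast)
  show "a \<le> sup a b" by transfer (rule finite_Collect_none, blast)
  show "b \<le> sup a b" by transfer (rule finite_Collect_none, blast)
  show "bot \<le> a" by transfer (rule finite_Collect_none, blast)
  show "a \<le> top" by transfer (rule finite_Collect_none, blast)
  show "sup a (inf b c) = inf (sup a b) (sup a c)"
    by transfer (unfold almost_equal_def, rule finite_Collect_none, blast)
  show "inf a (- a) = bot" by transfer (simp add: almost_equal_def)
  show "sup a (- a) = top" by transfer (simp add: almost_equal_def)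
  show "a \<le> c" if "a \<le> b" "b \<le> c"
    using that
  proof transfer
    fix a b c :: "nat \<Rightarrow> bool"
    assume "finite {n. a n \<and> \<not> b n}" "finite {n. b n \<and> \<not> c n}"
    then have "finite ({n. a n \<and> \<not> b n} \<union> {n. b n \<and> \<not> c n})" by simp
    then show "finite {n. a n \<and> \<not> c n}" by (rule rev_finite_subset) auto
  qed
  show "a = b" if "a \<le> b" "b \<le> a"
    using that
  proof transfer
    fix a b :: "nat \<Rightarrow> bool"
    assume "finite {n. a n \<and> \<not> b n}" "finite {n. b n \<and> \<not> a n}"
    then have "finite ({n. a n \<and> \<not> b n} \<union> {n. b n \<and> \<not> a n})" by simp
    then show "almost_equal a b"
      unfolding almost_equal_def by (rule rev_finite_subset) auto
  qed
  show "a \<le> inf b c" if "a \<le> b" "a \<le> c"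
    using that
  proof transfer
    fix a b c :: "nat \<Rightarrow> bool"
    assume "finite {n. a n \<and> \<not> b n}" "finite {n. a n \<and> \<not> c n}"
    then have "finite ({n. a n \<and> \<not> b n} \<union> {n. a n \<and> \<not> c n})" by simp
    then show "finite {n. a n \<and> \<not> (b n \<and> c n)}" by (rule rev_finite_subset) auto
  qed
  show "sup b c \<le> a" if "b \<le> a" "c \<le> a"
    using that
  proof transfer
    fix a b c :: "nat \<Rightarrow> bool"
    assume "finite {n. b n \<and> \<not> a n}" "finite {n. c n \<and> \<not> a n}"
    then have "finite ({n. b n \<and> \<not> a n} \<union> {n. c n \<and> \<not> a n})" by simp
    then show "finite {n. (b n \<or> c n) \<and> \<not> a n}" by (rule rev_finite_subset) auto
  qed
qed

end


section \<open>Signatures\<close>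

definition ind :: "(nat \<Rightarrow> riemann_sphere set) \<Rightarrow> riemann_sphere \<Rightarrow> binary_class" where
  "ind U c = binary_class (\<lambda>n. c \<in> U n)"

definition shrinks_to :: "riemann_sphere set \<Rightarrow> (riemann_sphere \<Rightarrow> riemann_sphere) \<Rightarrow> nat \<Rightarrow>
    (nat \<Rightarrow> nat \<Rightarrow> riemann_sphere set) \<Rightarrow> (nat \<Rightarrow> riemann_sphere) \<Rightarrow> bool" where
  "shrinks_to S f d U x \<longleftrightarrow>
     (\<forall>j. plaque S f d (U j) \<and> x \<in> plaque_points S f (U j)) \<and>
     (\<forall>j. plaque_points S f (U (Suc j)) \<subseteq> plaque_points S f (U j)) \<and>
     (\<forall>W. plaque S f d W \<and> x \<in> plaque_points S f W \<longrightarrow>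
          (\<exists>m. plaque_points S f (U m) \<subseteq> plaque_points S f W))"

text \<open>
  The signature is a relation because a point that lies in no plaque has none. Take
  \<open>f z = z\<^sup>2 + c\<close> on the sphere with the orbit of 0 unbounded: if \<open>(U\<^sub>1, U\<^sub>2, \<dots>)\<close>
  were a plaque containing the constant sequence at \<open>Infty\<close>, then each \<open>U\<^sub>i\<^sub>+\<^sub>1\<close> would be a connected
  component of the preimage of \<open>U\<^sub>i\<close>, and some \<open>U\<^sub>i\<close> would contain both critical points.
  By \<open>is_signature_unique\<close> below, no point has more than one signature.
\<close>

definition is_signature :: "riemann_sphere set \<Rightarrow> (riemann_sphere \<Rightarrow> riemann_sphere) \<Rightarrow> nat \<Rightarrow>
    (nat \<Rightarrow> riemann_sphere) \<Rightarrow> riemann_sphere \<Rightarrow> binary_class set \<Rightarrow> bool" where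
  "is_signature S f d x c \<sigma> \<longleftrightarrow> (\<exists>U. shrinks_to S f d U x \<and> \<sigma> = (\<Inter>j. {b. b \<le> ind (U j) c}))"

lemma plaque_points_subsetD:
  assumes U: "plaque S f d U" and sub: "plaque_points S f U \<subseteq> plaque_points S f W"
  shows "U i \<subseteq> W i"
proof
  fix p assume p: "p \<in> U i"
  have img: "f ` U (Suc k) = U k" and inS: "U k \<subseteq> S" for k
    using U by (auto simp: plaque_def)
  have "\<exists>g. g 0 = p \<and> (\<forall>k. g k \<in> U (i + k) \<and> f (g (Suc k)) = g k)"
  proof -
    have "\<exists>g. \<forall>k. (g k \<in> U (i + k) \<and> (k = 0 \<longrightarrow> g k = p)) \<and> f (g (Suc k)) = g k"
    proof (rule dependent_nat_choice)
      show "\<exists>q. q \<in> U (i + 0) \<and> (0 = (0::nat) \<longrightarrow> q = p)" using p by auto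
      fix q k assume "q \<in> U (i + k) \<and> (k = 0 \<longrightarrow> q = p)"
      then have "q \<in> f ` U (Suc (i + k))" using img by simp
      then show "\<exists>r. (r \<in> U (i + Suc k) \<and> (Suc k = 0 \<longrightarrow> r = p)) \<and> f r = q" by auto
    qed
    then show ?thesis by blast
  qed
  then obtain g where g0: "g 0 = p" and gU: "\<And>k. g k \<in> U (i + k)"
    and gf: "\<And>k. f (g (Suc k)) = g k" by blast
  have down: "k \<le> i \<Longrightarrow> (f ^^ k) p \<in> U (i - k)" for k
  proof (induction k)
    case 0 then show ?case using p by simp
  next
    case (Suc k)
    then have "(f ^^ k) p \<in> U (Suc (i - Suc k))" by (simp add: Suc_diff_Suc)
    then have "f ((f ^^ k) p) \<in> U (i - Suc k)" using img by blast
    then show ?case by simp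
  qed
  define x where "x k = (if k \<le> i then (f ^^ (i - k)) p else g (k - i))" for k
  have xU: "x k \<in> U k" for k
  proof (cases "k \<le> i")
    case True then show ?thesis using down[of "i - k"] by (simp add: x_def)
  next
    case False then show ?thesis using gU[of "k - i"] by (simp add: x_def)
  qed
  have xf: "f (x (Suc k)) = x k" for k
  proof -
    consider "Suc k \<le> i" | "k = i" | "i < k" by linarith
    then show ?thesis
    proof cases
      case 1
      then have "i - k = Suc (i - Suc k)" by simp
      then show ?thesis using 1 by (simp add: x_def)
    next
      case 2
      then show ?thesis using gf[of 0] g0 by (simp add: x_def)
    next
      case 3
      then have "Suc k - i = Suc (k - i)" by simp
      then show ?thesis using 3 gf[of "k - i"] by (simp add: x_def)
    qed
  qed
  have "x \<in> plaque_points S f U"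
    using xU xf inS by (auto simp: plaque_points_def inverse_limit_def)
  then have "x i \<in> W i" using sub by (auto simp: plaque_points_def)
  then show "p \<in> W i" by (simp add: x_def)
qed

lemma ind_mono: "(\<And>i. U i \<subseteq> W i) \<Longrightarrow> ind U c \<le> ind W c"
proof -
  assume *: "\<And>i. U i \<subseteq> W i"
  then show ?thesis
    unfolding ind_def less_eq_binary_class.abs_eq by (intro finite_Collect_none) blast
qed

lemma is_signature_unique:
  assumes "is_signature S f d x c \<sigma>" "is_signature S f d x c \<tau>"
  shows "\<sigma> = \<tau>"
proof -
  have le: "(\<Inter>j. {b. b \<le> ind (U j) c}) \<subseteq> (\<Inter>j. {b. b \<le> ind (W j) c})"
    if U: "shrinks_to S f d U x" and W: "shrinks_to S f d W x" for U W
  proof (rule INT_greatest)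
    fix j
    have "plaque S f d (W j) \<and> x \<in> plaque_points S f (W j)"
      using W by (simp add: shrinks_to_def)
    moreover have "\<forall>W. plaque S f d W \<and> x \<in> plaque_points S f W \<longrightarrow>
        (\<exists>m. plaque_points S f (U m) \<subseteq> plaque_points S f W)"
      using U by (simp add: shrinks_to_def)
    ultimately obtain m where m: "plaque_points S f (U m) \<subseteq> plaque_points S f (W j)"
      by blast
    have "plaque S f d (U m)" using U by (simp add: shrinks_to_def)
    from plaque_points_subsetD[OF this m] have "ind (U m) c \<le> ind (W j) c"
      by (rule ind_mono)
    then have "{b. b \<le> ind (U m) c} \<subseteq> {b. b \<le> ind (W j) c}"
      using order_trans by auto
    then show "(\<Inter>j. {b. b \<le> ind (U j) c}) \<subseteq> {b. b \<le> ind (W j) c}"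
      by blast
  qed
  obtain U where U: "shrinks_to S f d U x" "\<sigma> = (\<Inter>j. {b. b \<le> ind (U j) c})"
    using assms(1) unfolding is_signature_def by blast
  obtain W where W: "shrinks_to S f d W x" "\<tau> = (\<Inter>j. {b. b \<le> ind (W j) c})"
    using assms(2) unfolding is_signature_def by blast
  show ?thesis
    unfolding U(2) W(2) using le[OF U(1) W(1)] le[OF W(1) U(1)] by (rule subset_antisym)
qed


section \<open>Inverse-critical sets\<close>

definition omega_limit :: "riemann_sphere set \<Rightarrow> (riemann_sphere \<Rightarrow> riemann_sphere) \<Rightarrow> riemann_sphere \<Rightarrow> riemann_sphere set" where
  "omega_limit S f c =
     {p \<in> S. \<exists>k :: nat \<Rightarrow> nat. strict_mono k \<and> (\<forall>t. k t > 0) \<and> (\<lambda>t. (f ^^ k t) c) \<longlonglongrightarrow> p}"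

definition inverse_critical :: "riemann_sphere set \<Rightarrow> (riemann_sphere \<Rightarrow> riemann_sphere) \<Rightarrow> riemann_sphere \<Rightarrow> riemann_sphere set \<Rightarrow> bool" where
  "inverse_critical S f c V \<longleftrightarrow>
     V \<subseteq> omega_limit S f c \<and>
     (\<forall>z\<in>V. \<forall>U. open U \<and> U \<subseteq> S \<and> simply_connected U \<and> z \<in> U \<longrightarrow>
        (\<exists>n\<ge>1. \<exists>y\<in>V. (f ^^ n) y = z \<and>
           c \<in> connected_component_set {p \<in> S. (f ^^ n) p \<in> U} y))"

definition Gamma_set :: "riemann_sphere set \<Rightarrow> (riemann_sphere \<Rightarrow> riemann_sphere) \<Rightarrow> riemann_sphere \<Rightarrow> riemann_sphere set" where
  "Gamma_set S f c = \<Union>{V. inverse_critical S f c V}"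

text \<open>
  The invariant lift of \<open>\<Gamma>(c)\<close> can contain regular points, whose signatures are trivial: if the
  orbit of \<open>c\<close> is dense in the sphere, then \<open>\<Gamma>(c)\<close> is the whole sphere, and the constant
  sequence at a repelling fixed point is a regular point of its invariant lift.
\<close>

definition invariant_lift :: "riemann_sphere set \<Rightarrow> (riemann_sphere \<Rightarrow> riemann_sphere) \<Rightarrow> riemann_sphere set \<Rightarrow> (nat \<Rightarrow> riemann_sphere) set" where
  "invariant_lift S f V = {x \<in> inverse_limit S f. \<forall>i. x i \<in> V}"

end

theory Submission
  imports Defs
begin

text \<open>
  Plaques pull back: if \<open>B'\<close> is a disk inside \<open>U\<^sub>i\<close>, a component of its preimage in \<open>U\<^sub>i\<^sub>+\<^sub>1\<close> is again
  a disk on which \<open>f\<close> is conjugate to a power map, so a point that lies in a plaque lies in arbitrarily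
  small ones. If infinitely many members of all these plaques contain \<open>c\<close>, the coordinates of the point
  form an inverse-critical set: push \<open>c\<close> forward to see that they are in \<open>\<omega>(c)\<close>, and use that plaque
  members are connected. Conversely, inverse-criticality of \<open>\<Gamma>(c)\<close>, applied repeatedly to
  neighbourhoods whose images at the starting point shrink, builds a backward orbit along which \<open>c\<close> lies
  infinitely often in the relevant component. A plaque member is a full connected component of the
  preimage, so it contains \<open>c\<close> at those times.
\<close>

section \<open>Charts of the sphere\<close>

text \<open>Only the bottom member of a plaque can be shrunk at will, because everything above it is
  then rebuilt by pulling back; a small disk chosen inside \<open>U i\<close> need not be a full
  pullback of its image. Smallness at a higher coordinate is therefore forced topologically, by a
  circle that the connected member \<open>W i\<close> cannot cross. Pullbacks are computed by an
  explicit formula in disk coordinates, so that the new exponent is visibly 1 or the old one and the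
  bound by \<open>d\<close> survives infinitely many steps. A point in no plaque has no signature.
  Non-triviality is therefore carried as one infinite index set along which every plaque of the
  point contains \<open>c\<close> with finitely many exceptions; irregularity follows from the same
  set. The construction from \<Gamma>(c) yields such a set without deciding whether the new point
  lies in a plaque; the way back to \<Gamma>(c) starts from a signature, which supplies one.\<close>

lemma coord_param [simp]: "coord_at p (param_at p h) = h"
  by (cases p) auto

lemma param_zero [simp]: "param_at p 0 = p"
  by (cases p) auto

lemma param_coord: "q \<in> range (param_at p) \<Longrightarrow> param_at p (coord_at p q) = q"
  by auto

lemma inj_param: "inj (param_at p)"
  by (metis coord_param injI)

text \<open>For the chart at \<open>Infty\<close> the compactness clause is the substance: a ball of
  radius \<open>r\<close> about 0 in \<open>A\<close> accounts for all \<open>z\<close> of modulus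
  above \<open>1/r\<close>, so the complement is bounded.\<close>

lemma open_param_image:
  assumes "open A" shows "open (param_at p ` A)"
proof (cases p)
  case (Fin a)
  have "Fin -` param_at p ` A = (+) a ` A" using Fin by auto
  moreover have "Infty \<notin> param_at p ` A" using Fin by auto
  ultimately show ?thesis using assms by (simp add: open_riemann_sphere_def open_translation)
next
  case Infty
  have eq: "Fin -` param_at p ` A = {z \<in> - {0}. inverse z \<in> A}"
  proof (intro subset_antisym subsetI)
    fix z assume "z \<in> {z \<in> - {0}. inverse z \<in> A}"
    then have "Fin z = param_at p (inverse z)" "inverse z \<in> A" using Infty by auto
    then show "z \<in> Fin -` param_at p ` A" by blast
  qed (use Infty in \<open>auto split: if_splits\<close>)
  have cont: "continuous_on (- {0}) (inverse :: complex \<Rightarrow> complex)"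
    by (intro continuous_intros) auto
  have "open ((- {0}) \<inter> inverse -` A)"
    using continuous_open_preimage[OF cont _ assms] by auto
  also have "(- {0}) \<inter> inverse -` A = Fin -` param_at p ` A" unfolding eq by auto
  finally have op: "open (Fin -` param_at p ` A)" .
  have "compact (- (Fin -` param_at p ` A))" if "Infty \<in> param_at p ` A"
  proof -
    have "0 \<in> A" using that Infty by (auto split: if_splits)
    then obtain r where r: "r > 0" "ball 0 r \<subseteq> A" using assms by (meson openE)
    have "norm z \<le> inverse r" if z: "z \<notin> {z \<in> - {0}. inverse z \<in> A}" for z
    proof (rule ccontr)
      assume *: "\<not> norm z \<le> inverse r"
      then have nz: "z \<noteq> 0" using r by auto
      have "norm (inverse z) < r" using * r nz
        by (simp add: norm_divide norm_inverse field_simps)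
      then show False using z r nz by auto
    qed
    then have "bounded (- (Fin -` param_at p ` A))"
      unfolding eq bounded_iff by blast
    then show ?thesis using op by (simp add: compact_eq_bounded_closed closed_def)
  qed
  then show ?thesis using op by (simp add: open_riemann_sphere_def)
qed

lemma continuous_Fin: "continuous_on UNIV Fin"
  by (subst continuous_on_open_vimage) (auto simp: open_riemann_sphere_def)

lemma continuous_param: "continuous_on UNIV (param_at p)"
proof (subst continuous_on_open_vimage; clarsimp)
  fix B :: "riemann_sphere set" assume B: "open B"
  show "open (param_at p -` B)"
  proof (cases p)
    case (Fin a)
    have "param_at p -` B = (+) (- a) ` (Fin -` B)" using Fin by force
    then show ?thesis using B by (simp only: open_riemann_sphere_def open_translation)
  next
    case Infty
    have eq: "param_at p -` B = ((- {0}) \<inter> inverse -` (Fin -` B)) \<union> (if Infty \<in> B then {0} else {})"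
      using Infty by (auto split: if_splits)
    have cont: "continuous_on (- {0}) (inverse :: complex \<Rightarrow> complex)"
      by (intro continuous_intros) auto
    have op: "open ((- {0}) \<inter> inverse -` (Fin -` B))"
      using B continuous_open_preimage[OF cont] by (auto simp: open_riemann_sphere_def)
    show ?thesis
    proof (cases "Infty \<in> B")
      case True
      then have "bounded (- (Fin -` B))" using B
        by (auto simp: open_riemann_sphere_def dest: compact_imp_bounded)
      then obtain R where R: "R > 0" "\<And>z. z \<notin> Fin -` B \<Longrightarrow> norm z \<le> R"
        by (auto simp: bounded_pos)
      \<comment> \<open>Points outside \<open>B\<close> have modulus at most \<open>R\<close>, so
        inversion sends the punctured ball of radius \<open>1/R\<close> into \<open>B\<close>.
        Adding this ball exhibits the preimage, which contains 0, as a union of two open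
        sets.\<close>
      have sub: "ball 0 (inverse R) \<subseteq> param_at p -` B"
      proof
        fix h :: complex assume h: "h \<in> ball 0 (inverse R)"
        show "h \<in> param_at p -` B"
        proof (cases "h = 0")
          case False
          then have "norm (inverse h) > R" using h R(1)
            by (simp add: norm_inverse norm_divide field_simps)
          then have "inverse h \<in> Fin -` B" using R(2)[of "inverse h"] by (meson not_le)
          then show ?thesis using False Infty by simp
        qed (use Infty True in auto)
      qed
      have "param_at p -` B = ((- {0}) \<inter> inverse -` (Fin -` B)) \<union> ball 0 (inverse R)"
      proof
        show "param_at p -` B \<subseteq> - {0} \<inter> inverse -` Fin -` B \<union> ball 0 (inverse R)"
          using eq R(1) by auto
        show "- {0} \<inter> inverse -` Fin -` B \<union> ball 0 (inverse R) \<subseteq> param_at p -` B"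
          using sub eq by blast
      qed
      then show ?thesis using op by (metis open_Un open_ball)
    next
      case False
      then show ?thesis using op unfolding eq by (simp only: if_False Un_empty_right)
    qed
  qed
qed

lemma open_Fin_image:
  assumes "open W" shows "open (Fin ` W)"
proof -
  have "Fin -` Fin ` W = W" "Infty \<notin> Fin ` W" by auto
  then show ?thesis using assms by (simp add: open_riemann_sphere_def)
qed

text \<open>Makes compact subsets closed, so that images of closed disks and circles can later be
  cut out of open sets.\<close>

instance riemann_sphere :: t2_space
proof
  fix p q :: riemann_sphere assume "p \<noteq> q"
  have aux: "\<exists>U V. open U \<and> open V \<and> Fin a \<in> U \<and> Infty \<in> V \<and> U \<inter> V = {}" for a
  proof -
    have "Fin -` (- Fin ` cball a 1) = - cball a 1" by auto
    then have "open (- Fin ` cball a 1)"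
      unfolding open_riemann_sphere_def by (simp only: double_compl) (simp add: open_Compl)
    moreover have "open (Fin ` ball a 1)" by (rule open_Fin_image) simp
    moreover have "Fin a \<in> Fin ` ball a 1" "Infty \<in> - Fin ` cball a 1" by auto
    moreover have "Fin ` ball a 1 \<inter> - Fin ` cball a 1 = {}" by auto
    ultimately show ?thesis by blast
  qed
  have aux2: "\<exists>U V. open U \<and> open V \<and> Fin a \<in> U \<and> Fin b \<in> V \<and> U \<inter> V = {}"
    if ab: "a \<noteq> b" for a b :: complex
  proof -
    obtain U V where UV: "open U" "open V" "a \<in> U" "b \<in> V" "U \<inter> V = {}"
      using hausdorff[OF ab] by blast
    then have "Fin ` U \<inter> Fin ` V = {}" by auto
    then show ?thesis
      using UV by (intro exI[of _ "Fin ` U"] exI[of _ "Fin ` V"]) (simp add: open_Fin_image)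
  qed
  show "\<exists>U V. open U \<and> open V \<and> p \<in> U \<and> q \<in> V \<and> U \<inter> V = {}"
  proof (cases p; cases q)
    fix a b assume "p = Fin a" "q = Fin b"
    then show ?thesis using aux2[of a b] \<open>p \<noteq> q\<close> by simp
  next
    fix a assume "p = Fin a" "q = Infty"
    then show ?thesis using aux[of a] by simp
  next
    fix b assume pq: "p = Infty" "q = Fin b"
    obtain U V where "open U" "open V" "Fin b \<in> U" "Infty \<in> V" "U \<inter> V = {}"
      using aux[of b] by blast
    then show ?thesis unfolding pq by (intro exI[of _ V] exI[of _ U]) (simp add: Int_commute)
  next
    assume "p = Infty" "q = Infty"
    then show ?thesis using \<open>p \<noteq> q\<close> by simp
  qed
qed

lemma param_ball_base:
  assumes "open W" "p \<in> W"
  obtains r where "r > 0" "param_at p ` ball 0 r \<subseteq> W"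
proof -
  have "open (param_at p -` W)"
    using continuous_param[of p] assms(1) by (simp add: continuous_on_open_vimage)
  moreover have "0 \<in> param_at p -` W" using assms by simp
  ultimately obtain r where "r > 0" "ball 0 r \<subseteq> param_at p -` W" by (meson openE)
  then show ?thesis using that by blast
qed

lemma simply_connected_param_ball: "simply_connected (param_at p ` ball 0 r)"
proof -
  have "homeomorphism (ball 0 r) (param_at p ` ball 0 r) (param_at p) (coord_at p)"
  proof (rule homeomorphismI)
    show "continuous_on (ball 0 r) (param_at p)"
      using continuous_param continuous_on_subset by blast
    \<comment> \<open>Continuity comes from openness of \<open>param_at p\<close>, as the formula
      for \<open>coord_at p\<close> has a junk value off the chart.\<close>
    show "continuous_on (param_at p ` ball 0 r) (coord_at p)"
      by (rule continuous_on_inverse_open_map[where f = "param_at p" and S = "ball 0 r"])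
         (use continuous_on_subset[OF continuous_param subset_UNIV] in
           \<open>auto simp: openin_open_eq open_param_image\<close>)
  qed auto
  then show ?thesis
    using homeomorphic_simply_connected[of "ball (0::complex) r"] convex_imp_simply_connected[of "ball (0::complex) r"]
    unfolding homeomorphic_def by blast
qed

section \<open>Holomorphic maps of the sphere\<close>

lemma tendsto_param: "(param_at p \<longlongrightarrow> p) (nhds 0)"
proof -
  have "isCont (param_at p) 0"
    using continuous_param[of p] by (simp add: continuous_on_eq_continuous_at)
  then show ?thesis by (simp add: isCont_def tendsto_nhds_iff)
qed

lemma eventually_param:
  assumes "open W" "p \<in> W"
  shows "\<forall>\<^sub>F h in nhds 0. param_at p h \<in> W"
  using tendsto_param assms by (rule topological_tendstoD)

lemma open_range_param: "open (range (param_at p))"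
  by (rule open_param_image) simp

lemma range_param_self: "p \<in> range (param_at p)"
  by (metis param_zero rangeI)

lemma local_expr_zero [simp]: "local_expr f p 0 = 0"
  by (metis local_expr_def param_zero coord_param)

text \<open>A germ of \<open>local_expr\<close> involves the values of the map near the centre, so
  agreement on \<open>S\<close> transfers because \<open>S\<close> is open.\<close>

lemma sphere_holomorphic_on_cong:
  assumes "open S" "\<And>p. p \<in> S \<Longrightarrow> f p = g p"
  shows "sphere_holomorphic_on f S \<longleftrightarrow> sphere_holomorphic_on g S"
proof -
  have "local_expr f p analytic_on {0} \<longleftrightarrow> local_expr g p analytic_on {0}" if p: "p \<in> S" for p
  proof (rule analytic_at_cong)
    show "\<forall>\<^sub>F h in nhds 0. local_expr f p h = local_expr g p h"
      using eventually_param[OF assms(1) p]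
      by eventually_elim (simp add: local_expr_def assms(2) p)
  qed simp
  moreover have "continuous_on S f \<longleftrightarrow> continuous_on S g"
    by (rule continuous_on_cong) (use assms in auto)
  ultimately show ?thesis by (simp add: sphere_holomorphic_on_def)
qed

lemma sphere_holomorphic_on_subset:
  "sphere_holomorphic_on f S \<Longrightarrow> T \<subseteq> S \<Longrightarrow> sphere_holomorphic_on f T"
  by (auto simp: sphere_holomorphic_on_def intro: continuous_on_subset)

lemma sphere_holomorphic_on_compose:
  assumes f: "sphere_holomorphic_on f S" and g: "sphere_holomorphic_on g T"
    and "open S" "f ` S \<subseteq> T"
  shows "sphere_holomorphic_on (g \<circ> f) S"
  unfolding sphere_holomorphic_on_def
proof (intro conjI ballI)
  show "continuous_on S (g \<circ> f)"
    using f g assms(4) by (metis sphere_holomorphic_on_def continuous_on_compose continuous_on_subset)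
  fix p assume p: "p \<in> S"
  have an: "local_expr f p analytic_on {0}" "local_expr g (f p) analytic_on {0}"
    using f g p assms(4) by (auto simp: sphere_holomorphic_on_def)
  \<comment> \<open>Near 0 the intermediate point stays in the chart at \<open>f p\<close>, where
    \<open>param_at\<close> undoes \<open>coord_at\<close>; there the local expressions
    compose.\<close>
  have "open (S \<inter> f -` range (param_at (f p)))"
    using continuous_open_preimage[OF _ \<open>open S\<close> open_range_param] f
    by (simp add: sphere_holomorphic_on_def)
  moreover have "p \<in> S \<inter> f -` range (param_at (f p))" using p range_param_self by simp
  ultimately have "\<forall>\<^sub>F h in nhds 0. param_at p h \<in> S \<inter> f -` range (param_at (f p))"
    by (rule eventually_param)
  then have "\<forall>\<^sub>F h in nhds 0. local_expr (g \<circ> f) p h = (local_expr g (f p) \<circ> local_expr f p) h"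
    by eventually_elim (simp add: local_expr_def param_coord)
  moreover have "(local_expr g (f p) \<circ> local_expr f p) analytic_on {0}"
    by (rule analytic_on_compose[OF an(1)]) (simp add: an(2))
  ultimately show "local_expr (g \<circ> f) p analytic_on {0}"
    using analytic_at_cong by blast
qed

text \<open>An injective holomorphic function has no zero of its derivative. This transfers to
  \<open>local_expr\<close> on a ball so small that \<open>f\<close> maps its image into the chart
  at \<open>f c\<close>.\<close>

lemma critical_point_not_injective:
  assumes f: "sphere_holomorphic_on f S" and "open U" "c \<in> U" "U \<subseteq> S" and inj: "inj_on f U"
  shows "\<not> critical_point f c"
proof -
  have f': "continuous_on U f" and an: "local_expr f c analytic_on {0}"
    using f assms by (auto simp: sphere_holomorphic_on_def intro: continuous_on_subset)
  have op: "open (U \<inter> f -` range (param_at (f c)))"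
    using continuous_open_preimage[OF f' \<open>open U\<close> open_range_param] by simp
  have mem: "c \<in> U \<inter> f -` range (param_at (f c))"
    using \<open>c \<in> U\<close> range_param_self by simp
  obtain r where r: "r > 0" "param_at c ` ball 0 r \<subseteq> U \<inter> f -` range (param_at (f c))"
    using param_ball_base[OF op mem] by metis
  obtain s where s: "s > 0" "local_expr f c holomorphic_on ball 0 s"
    using an by (auto simp: analytic_on_def)
  define t where "t = min r s"
  have "local_expr f c holomorphic_on ball 0 t"
    using s(2) by (rule holomorphic_on_subset) (auto simp: t_def)
  moreover have "inj_on (local_expr f c) (ball 0 t)"
  proof (rule inj_onI)
    fix h k assume hk: "h \<in> ball 0 t" "k \<in> ball 0 t" "local_expr f c h = local_expr f c k"
    have *: "param_at c h \<in> U" "param_at c k \<in> U"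
      "f (param_at c h) \<in> range (param_at (f c))" "f (param_at c k) \<in> range (param_at (f c))"
      using hk(1,2) subsetD[OF r(2) imageI, of h] subsetD[OF r(2) imageI, of k] by (auto simp: t_def)
    have "f (param_at c h) = f (param_at c k)"
      using hk(3) param_coord[OF *(3)] param_coord[OF *(4)] unfolding local_expr_def by argo
    then have "param_at c h = param_at c k" using inj * by (simp add: inj_on_def)
    then show "h = k" using inj_param by (metis injD)
  qed
  ultimately have "deriv (local_expr f c) 0 \<noteq> 0"
    by (rule holomorphic_injective_imp_regular[OF _ open_ball]) (use r s t_def in auto)
  then show ?thesis by (simp add: critical_point_def)
qed

section \<open>Conformal isomorphisms between open sets\<close>

lemma conformal_isoD:
  assumes "conformal_iso A B \<phi>"
  shows "bij_betw \<phi> A B" "continuous_on A \<phi>" "continuous_on B (inv_into A \<phi>)"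
    "sphere_holomorphic_on \<phi> A" "sphere_holomorphic_on (inv_into A \<phi>) B"
  using assms by (auto simp: conformal_iso_def sphere_holomorphic_on_def)

text \<open>Lets an explicit inverse \<psi> replace \<open>inv_into A \<phi>\<close>: both agree on
  the open set \<open>B\<close>, so one is holomorphic there if the other is.\<close>

lemma conformal_isoI:
  assumes "open A" "open B" "sphere_holomorphic_on \<phi> A" "sphere_holomorphic_on \<psi> B"
    and im: "\<And>p. p \<in> A \<Longrightarrow> \<phi> p \<in> B" "\<And>q. q \<in> B \<Longrightarrow> \<psi> q \<in> A"
    and inv: "\<And>p. p \<in> A \<Longrightarrow> \<psi> (\<phi> p) = p" "\<And>q. q \<in> B \<Longrightarrow> \<phi> (\<psi> q) = q"
  shows "conformal_iso A B \<phi>"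
proof -
  have bij: "bij_betw \<phi> A B"
    by (rule bij_betw_byWitness[where f' = \<psi>]) (use im inv in auto)
  then have "inv_into A \<phi> q = \<psi> q" if "q \<in> B" for q
    using that im inv by (metis bij_betw_imp_inj_on inv_into_f_eq)
  then show ?thesis
    using bij assms sphere_holomorphic_on_cong[of B "inv_into A \<phi>" \<psi>]
    by (simp add: conformal_iso_def)
qed

lemma conformal_iso_image_mem: "conformal_iso A B \<phi> \<Longrightarrow> p \<in> A \<Longrightarrow> \<phi> p \<in> B"
  by (auto simp: conformal_iso_def bij_betw_def)

lemma conformal_iso_inv_mem: "conformal_iso A B \<phi> \<Longrightarrow> q \<in> B \<Longrightarrow> inv_into A \<phi> q \<in> A"
  by (auto simp: conformal_iso_def bij_betw_def intro: inv_into_into)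

lemma conformal_iso_f_inv: "conformal_iso A B \<phi> \<Longrightarrow> q \<in> B \<Longrightarrow> \<phi> (inv_into A \<phi> q) = q"
  by (auto simp: conformal_iso_def bij_betw_def f_inv_into_f)

lemma conformal_iso_inv_f: "conformal_iso A B \<phi> \<Longrightarrow> p \<in> A \<Longrightarrow> inv_into A \<phi> (\<phi> p) = p"
  by (auto simp: conformal_iso_def bij_betw_def)

lemmas conformal_iso_rules = conformal_iso_image_mem conformal_iso_inv_mem
  conformal_iso_f_inv conformal_iso_inv_f

lemma conformal_iso_inv:
  assumes "open A" "open B" "conformal_iso A B \<phi>"
  shows "conformal_iso B A (inv_into A \<phi>)"
  using assms by (intro conformal_isoI[where \<psi> = \<phi>]) (auto simp: conformal_isoD conformal_iso_rules)

lemma conformal_iso_compose: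
  assumes "open A" "open B" "open C" and \<phi>: "conformal_iso A B \<phi>" and \<psi>: "conformal_iso B C \<psi>"
  shows "conformal_iso A C (\<psi> \<circ> \<phi>)"
proof (rule conformal_isoI[where \<psi> = "inv_into A \<phi> \<circ> inv_into B \<psi>"])
  show "sphere_holomorphic_on (\<psi> \<circ> \<phi>) A"
    by (rule sphere_holomorphic_on_compose[where T = B])
       (use assms in \<open>auto simp: conformal_isoD conformal_iso_rules\<close>)
  show "sphere_holomorphic_on (inv_into A \<phi> \<circ> inv_into B \<psi>) C"
    by (rule sphere_holomorphic_on_compose[where T = B])
       (use assms in \<open>auto simp: conformal_isoD conformal_iso_rules\<close>)
qed (use assms conformal_iso_rules[OF \<phi>] conformal_iso_rules[OF \<psi>] in auto)

text \<open>Writes an image as a preimage under the continuous inverse, whence images of open sets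
  are open.\<close>

lemma conformal_iso_image_eq_vimage:
  assumes "conformal_iso A B \<phi>" "V \<subseteq> A"
  shows "\<phi> ` V = B \<inter> inv_into A \<phi> -` V"
proof (intro subset_antisym subsetI)
  fix q assume q: "q \<in> B \<inter> inv_into A \<phi> -` V"
  then have "q = \<phi> (inv_into A \<phi> q)" using conformal_iso_f_inv[OF assms(1)] by simp
  then show "q \<in> \<phi> ` V" using q by blast
qed (use assms conformal_iso_rules[OF assms(1)] in auto)

lemma conformal_iso_open_image:
  assumes "open B" "conformal_iso A B \<phi>" "V \<subseteq> A" "open V"
  shows "open (\<phi> ` V)"
  unfolding conformal_iso_image_eq_vimage[OF assms(2,3)]
  by (rule continuous_open_preimage) (use assms conformal_isoD in auto)

lemma conformal_iso_restrict:
  assumes "open A" "open B" and \<phi>: "conformal_iso A B \<phi>" and V: "V \<subseteq> A" "open V"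
  shows "conformal_iso V (\<phi> ` V) \<phi>"
proof (rule conformal_isoI[where \<psi> = "inv_into A \<phi>"])
  have "\<phi> ` V \<subseteq> B" using V conformal_iso_rules[OF \<phi>] by auto
  then show "sphere_holomorphic_on (inv_into A \<phi>) (\<phi> ` V)"
    using conformal_isoD(5)[OF \<phi>] sphere_holomorphic_on_subset by blast
  show "sphere_holomorphic_on \<phi> V"
    using conformal_isoD(4)[OF \<phi>] V sphere_holomorphic_on_subset by blast
  show "open (\<phi> ` V)" using conformal_iso_open_image assms by blast
  show "inv_into A \<phi> q \<in> V" if "q \<in> \<phi> ` V" for q
    using that V conformal_iso_rules[OF \<phi>] by auto
  show "\<phi> (inv_into A \<phi> q) = q" if "q \<in> \<phi> ` V" for q
    using that V conformal_iso_rules[OF \<phi>] by auto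
  show "inv_into A \<phi> (\<phi> p) = p" if "p \<in> V" for p
    using that V conformal_iso_rules[OF \<phi>] by auto
qed (use V in auto)

definition sphere_lift :: "(complex \<Rightarrow> complex) \<Rightarrow> riemann_sphere \<Rightarrow> riemann_sphere" where
  "sphere_lift h p = (case p of Fin z \<Rightarrow> Fin (h z) | Infty \<Rightarrow> Infty)"

lemma sphere_lift_Fin [simp]: "sphere_lift h (Fin z) = Fin (h z)"
  by (simp add: sphere_lift_def)

text \<open>\<open>coord_at (Fin 0)\<close> inverts \<open>Fin\<close>; from here on it reads off
  the complex number behind a finite point. Its continuity is the openness of
  \<open>Fin\<close>.\<close>

lemma continuous_on_the_Fin: "continuous_on (range Fin) (coord_at (Fin 0))"
proof -
  have "openin (top_of_set (range Fin)) (Fin ` U)" if "openin (top_of_set UNIV) U" for U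
  proof -
    have "open (Fin ` U)" using that by (auto intro: open_Fin_image)
    then show ?thesis by (metis Int_absorb1 UNIV_I image_mono openin_open_Int subsetI)
  qed
  then show ?thesis
    by (intro continuous_on_inverse_open_map[where f = Fin and S = UNIV])
       (auto simp: continuous_Fin)
qed

lemma sphere_holomorphic_on_lift:
  assumes "h holomorphic_on A" "open A"
  shows "sphere_holomorphic_on (sphere_lift h) (Fin ` A)"
  unfolding sphere_holomorphic_on_def
proof (intro conjI ballI)
  have "continuous_on (coord_at (Fin 0) ` Fin ` A) h"
    using assms holomorphic_on_imp_continuous_on by (simp add: image_image)
  moreover have "continuous_on (Fin ` A) (coord_at (Fin 0))"
    using continuous_on_the_Fin by (rule continuous_on_subset) auto
  ultimately have "continuous_on (Fin ` A) (Fin \<circ> (h \<circ> coord_at (Fin 0)))"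
    by (intro continuous_on_compose) (auto intro: continuous_on_subset[OF continuous_Fin])
  then show "continuous_on (Fin ` A) (sphere_lift h)"
    by (rule continuous_on_eq) auto
  fix p assume "p \<in> Fin ` A"
  then obtain a where a: "p = Fin a" "a \<in> A" by auto
  have "h analytic_on {a + 0}" using assms a by (simp add: analytic_on_holomorphic) blast
  then have "(h \<circ> (\<lambda>z. a + z)) analytic_on {0}"
    by (intro analytic_on_compose) (auto intro!: analytic_intros)
  then have "(\<lambda>z. h (a + z) - h a) analytic_on {0}"
    by (auto simp: o_def intro!: analytic_intros)
  moreover have "local_expr (sphere_lift h) p = (\<lambda>z. h (a + z) - h a)"
    using a by (auto simp: local_expr_def)
  ultimately show "local_expr (sphere_lift h) p analytic_on {0}" by simp
qed

lemma conformal_iso_lift: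
  assumes "h holomorphic_on A" "open A" "inj_on h A"
  shows "conformal_iso (Fin ` A) (Fin ` h ` A) (sphere_lift h)"
proof -
  obtain k where k: "k holomorphic_on (h ` A)" "\<And>z. z \<in> A \<Longrightarrow> k (h z) = z"
    using holomorphic_has_inverse[OF assms] by metis
  have "open (h ` A)" using open_mapping_thm3[OF assms] .
  then show ?thesis
    by (intro conformal_isoI[where \<psi> = "sphere_lift k"])
       (use assms k in \<open>auto intro!: sphere_holomorphic_on_lift open_Fin_image\<close>)
qed

lemma open_unit_disk: "open unit_disk"
  by (simp add: unit_disk_def open_Fin_image)

section \<open>Lifting a univalent map through a power map\<close>

lemma norm_power_less_one_iff:
  fixes z :: complex
  assumes "t \<ge> 1" shows "norm (z ^ t) < 1 \<longleftrightarrow> norm z < 1"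
proof -
  have "t > 0" using assms by simp
  then show ?thesis
    by (metis norm_ge_zero norm_power not_less one_le_power power_Suc_less_one power_less_one_iff)
qed

lemma exists_unit_disk_root:
  fixes w :: complex
  assumes "t \<ge> 1" "w \<in> ball 0 1"
  obtains z where "z \<in> ball 0 1" "z ^ t = w"
proof -
  have "t \<noteq> 0" using assms by simp
  then obtain z where z: "z ^ t = w" using exists_complex_root by metis
  then show ?thesis using that[of z] norm_power_less_one_iff[OF assms(1), of z] assms(2) by auto
qed

lemma holomorphic_root_on_disk:
  assumes "g holomorphic_on ball 0 1" "\<And>w. w \<in> ball 0 1 \<Longrightarrow> g w \<noteq> 0" "t \<ge> 1"
  obtains h where "h holomorphic_on ball 0 1" "\<And>w. w \<in> ball (0::complex) 1 \<Longrightarrow> h w ^ t = g w"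
proof -
  obtain L where L: "L holomorphic_on ball 0 1" "\<And>w. w \<in> ball 0 1 \<Longrightarrow> g w = exp (L w)"
    using contractible_imp_holomorphic_log[OF assms(1) _ assms(2)] convex_imp_contractible[OF convex_ball]
    by metis
  have "exp (L w / of_nat t) ^ t = exp (L w)" for w
    using assms(3) by (simp add: exp_of_nat_mult[symmetric])
  moreover have "(\<lambda>w. exp (L w / of_nat t)) holomorphic_on ball 0 1"
    using L(1) assms(3) by (intro holomorphic_intros) auto
  ultimately show thesis using that[of "\<lambda>w. exp (L w / of_nat t)"] L(2) by metis
qed

text \<open>
  If \<open>g\<close> has no zero, \<open>G\<close> is a branch of its \<open>t\<close>-th root and \<open>s = 1\<close>. Otherwise \<open>M\<close> moves the zero to
  the origin, \<open>g (M w) = w v(w)\<^sup>t\<close>, and \<open>G w = w v(w\<^sup>t)\<close> with \<open>s = t\<close>.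
\<close>

lemma power_lift_of_univalent:
  fixes g :: "complex \<Rightarrow> complex"
  assumes hol: "g holomorphic_on ball 0 1" and inj: "inj_on g (ball 0 1)"
    and t: "t \<ge> 1" and z0: "z0 ^ t \<in> g ` ball 0 1"
  obtains M G s where "M holomorphic_on ball 0 1" "M ` ball 0 1 = ball 0 1" "inj_on M (ball 0 1)"
    "G holomorphic_on ball 0 1" "inj_on G (ball 0 1)" "z0 \<in> G ` ball 0 1" "s = 1 \<or> s = t"
    "\<And>w. w \<in> ball 0 1 \<Longrightarrow> G w ^ t = g (M (w ^ s))"
proof (cases "\<exists>w\<in>ball 0 1. g w = 0")
  case False
  obtain h where h: "h holomorphic_on ball 0 1" "\<And>w. w \<in> ball 0 1 \<Longrightarrow> h w ^ t = g w"
    using holomorphic_root_on_disk[OF hol _ t] False by metis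
  obtain w0 where w0: "w0 \<in> ball 0 1" "z0 ^ t = g w0" using z0 by blast
  have hw0: "h w0 \<noteq> 0" 
  proof
    assume "h w0 = 0"
    then have "g w0 = 0" using h(2)[OF w0(1)] t by (simp add: power_0_left)
    then show False using False w0(1) by blast
  qed
  \<comment> \<open>At \<open>w0\<close> the branch \<open>h\<close> may miss \<open>z0\<close> by a
    root of unity; \<zeta> rotates it so that it passes through \<open>z0\<close>.\<close>
  define \<zeta> where "\<zeta> = z0 / h w0"
  have \<zeta>: "\<zeta> ^ t = 1"
    using hw0 w0(2) h(2)[OF w0(1), symmetric] by (simp add: \<zeta>_def power_divide)
  define G where "G w = \<zeta> * h w" for w
  have Gt: "G w ^ t = g w" if "w \<in> ball 0 1" for w
    using h(2)[OF that] \<zeta> by (simp add: G_def power_mult_distrib)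
  show thesis
  proof (rule that[of "\<lambda>z. z" G 1])
    show "G holomorphic_on ball 0 1" unfolding G_def using h(1) by (intro holomorphic_intros)
    show "inj_on G (ball 0 1)" using Gt inj by (metis inj_on_def)
    have "z0 = G w0" using hw0 by (simp add: G_def \<zeta>_def)
    then show "z0 \<in> G ` ball 0 1" using w0(1) by blast
  qed (use Gt in auto)
next
  case True
  then obtain w1 where w1: "w1 \<in> ball 0 1" "g w1 = 0" by blast
  obtain p q where pq: "p w1 = 0" "p ` ball 0 1 \<subseteq> ball 0 1" "q holomorphic_on ball 0 1"
    "q ` ball 0 1 \<subseteq> ball 0 1" "\<And>z. z \<in> ball 0 1 \<Longrightarrow> p (q z) = z" "\<And>z. z \<in> ball 0 1 \<Longrightarrow> q (p z) = z"
    using ball_biholomorphism_exists[OF w1(1)] by metis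
  have q0: "q 0 = w1" using pq(1) pq(6)[OF w1(1)] by simp
  have injq: "inj_on q (ball 0 1)" using pq(5) by (metis inj_on_inverseI)
  define k where "k = g \<circ> q"
  have holk: "k holomorphic_on ball 0 1"
    unfolding k_def using pq(3,4) hol by (metis holomorphic_on_compose holomorphic_on_subset)
  have injk: "inj_on k (ball 0 1)"
    unfolding k_def using injq inj pq(4) by (metis comp_inj_on inj_on_subset)
  have k0: "k 0 = 0" using q0 w1 by (simp add: k_def)
  \<comment> \<open>The quotient \<open>k z / z\<close> with its removable singularity filled in.
    Injectivity of \<open>k\<close> makes it zero-free, at 0 because the derivative of
    \<open>k\<close> does not vanish there.\<close>
  define u where "u = (\<lambda>z. if z = 0 then deriv k 0 else (k z - k 0) / (z - 0))"
  have holu: "u holomorphic_on ball 0 1"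
    unfolding u_def by (rule pole_lemma_open[OF holk]) simp
  have ku: "k z = z * u z" for z using k0 by (simp add: u_def)
  have "u z \<noteq> 0" if z: "z \<in> ball 0 1" for z
  proof (cases "z = 0")
    case True
    then show ?thesis using holomorphic_injective_imp_regular[OF holk _ injk, of 0] by (simp add: u_def)
  next
    case False
    then have "k z \<noteq> k 0" using injk z by (auto simp: inj_on_def)
    then show ?thesis using False by (simp add: u_def)
  qed
  then obtain v where v: "v holomorphic_on ball 0 1" "\<And>w. w \<in> ball 0 1 \<Longrightarrow> v w ^ t = u w"
    using holomorphic_root_on_disk[OF holu _ t] by metis
  have v0: "v w \<noteq> 0" if "w \<in> ball 0 1" for w
    using v(2)[OF that] \<open>\<And>z. z \<in> ball 0 1 \<Longrightarrow> u z \<noteq> 0\<close>[OF that] t by (metis not_one_le_zero power_0_left)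
  define G where "G w = w * v (w ^ t)" for w
  have pow: "w ^ t \<in> ball 0 1" if "w \<in> ball 0 1" for w :: complex
    using that norm_power_less_one_iff[OF t] by simp
  have Gt: "G w ^ t = k (w ^ t)" if "w \<in> ball 0 1" for w
    using v(2)[OF pow[OF that]] by (simp add: G_def ku power_mult_distrib)
  have "(v \<circ> (\<lambda>w. w ^ t)) holomorphic_on ball 0 1"
    by (rule holomorphic_on_compose_gen[OF _ v(1)]) (use pow in \<open>auto intro!: holomorphic_intros\<close>)
  then have holG: "G holomorphic_on ball 0 1"
    unfolding G_def by (auto simp: o_def intro!: holomorphic_intros)
  have injG: "inj_on G (ball 0 1)"
  proof (rule inj_onI)
    fix w w' :: complex assume w: "w \<in> ball 0 1" "w' \<in> ball 0 1" "G w = G w'"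
    \<comment> \<open>Taking \<open>t\<close>-th powers forgets a root of unity, which is recovered
      afterwards: once \<open>w ^ t = w' ^ t\<close>, the common factor \<open>v (w ^ t)\<close> is
      non-zero and cancels in \<open>G w = G w'\<close>.\<close>
    then have "k (w ^ t) = k (w' ^ t)" using Gt by metis
    then have "w ^ t = w' ^ t" using injk pow w by (metis inj_onD)
    then show "w = w'" using w(3) v0[OF pow[OF w(1)]] by (simp add: G_def)
  qed
  have z0G: "z0 \<in> G ` ball 0 1"
  proof -
    obtain w0 where w0: "w0 \<in> ball 0 1" "z0 ^ t = g w0" using z0 by blast
    have "p w0 \<in> ball 0 1" using pq(2) w0(1) by blast
    then obtain w where w: "w \<in> ball 0 1" "w ^ t = p w0" using exists_unit_disk_root[OF t] by metis
    have eq: "G w ^ t = z0 ^ t" using Gt[OF w(1)] w0 pq(6) by (simp add: k_def w(2))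
    show ?thesis
    proof (cases "z0 = 0")
      case True
      then have "G w = 0" using eq t by (simp add: power_0_left)
      then show ?thesis using w(1) True by (metis imageI)
    next
      case False
      then have "z0 ^ t \<noteq> 0" using False by simp
      then have nz: "G w \<noteq> 0" using eq t by (metis power_0_left not_one_le_zero)
      \<comment> \<open>Multiplying \<open>w\<close> by a \<open>t\<close>-th root of unity leaves
        \<open>w ^ t\<close> alone, hence multiplies \<open>G w\<close> by the same root. So
        \<open>G\<close> reaches \<open>z0\<close>, which has the same \<open>t\<close>-th power as
        \<open>G w\<close>.\<close>
      define \<zeta> where "\<zeta> = z0 / G w"
      have \<zeta>: "\<zeta> ^ t = 1" using nz eq[symmetric] by (simp add: \<zeta>_def power_divide)
      have "G (\<zeta> * w) = \<zeta> * G w" by (simp add: G_def power_mult_distrib \<zeta>)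
      also have "\<dots> = z0" using nz by (simp add: \<zeta>_def)
      finally have "G (\<zeta> * w) = z0" .
      moreover have "(\<zeta> * w) ^ t = w ^ t" by (simp add: power_mult_distrib \<zeta>)
      then have "\<zeta> * w \<in> ball 0 1" using norm_power_less_one_iff[OF t] w(1) by (metis mem_ball_0)
      ultimately show ?thesis by blast
    qed
  qed
  show thesis
  proof (rule that[of q G t])
    show "q ` ball 0 1 = ball 0 1" using pq(2,4,6) by force
  qed (use pq(3) injq holG injG z0G Gt in \<open>auto simp: k_def\<close>)
qed

section \<open>Pulling a disk back through a power map\<close>

lemma holomorphic_on_coord:
  assumes F: "sphere_holomorphic_on F (Fin ` A)" and "open A" and im: "F ` Fin ` A \<subseteq> range Fin"
  shows "(\<lambda>w. coord_at (Fin 0) (F (Fin w))) holomorphic_on A"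
proof -
  define g where "g = (\<lambda>w. coord_at (Fin 0) (F (Fin w)))"
  have Fg: "F (Fin w) = Fin (g w)" if "w \<in> A" for w
  proof -
    have "F (Fin w) \<in> range Fin" using im that by blast
    then show ?thesis by (auto simp: g_def)
  qed
  have "g analytic_on {a}" if a: "a \<in> A" for a
  proof -
    \<comment> \<open>Near 0, \<open>local_expr F (Fin a) h\<close> is
      \<open>g (a + h) - g a\<close>; both translations are undone.\<close>
    have "local_expr F (Fin a) analytic_on {a + (- a)}"
      using F a by (simp add: sphere_holomorphic_on_def)
    then have "(local_expr F (Fin a) \<circ> (\<lambda>w. w + (- a))) analytic_on {a}"
      by (intro analytic_on_compose) (auto intro!: analytic_intros)
    then have an: "(\<lambda>w. g a + (local_expr F (Fin a) \<circ> (\<lambda>w. w + (- a))) w) analytic_on {a}"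
      by (intro analytic_intros)
    have ev: "\<forall>\<^sub>F w in nhds a. g w = g a + (local_expr F (Fin a) \<circ> (\<lambda>w. w + (- a))) w"
      using eventually_nhds_in_open[OF \<open>open A\<close> a]
      by eventually_elim (simp add: local_expr_def Fg a)
    show ?thesis using an analytic_at_cong[OF ev refl] by blast
  qed
  then have "g analytic_on A" by (meson analytic_on_analytic_at)
  then show ?thesis unfolding g_def by (rule analytic_imp_holomorphic)
qed

text \<open>In disk coordinates \<open>B'\<close> is the image of the univalent map
  \<open>g\<close>, which is \<psi> after the inverse of \<eta>. The identity
  \<open>G w ^ t = g (M (w ^ s))\<close> says that \<open>f\<close> becomes \<open>w ^ s\<close>
  when the source is parametrised by \<open>G\<close> and the target by \<open>g\<close> after
  \<open>M\<close>. So \<open>A'\<close> is the image of the disk under \<open>G\<close>, read in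
  \<open>A\<close>; it contains \<open>a\<close> because \<open>G\<close> passes through the
  coordinate \<open>z0\<close> of \<open>a\<close>.\<close>

lemma pullback_power_disk:
  assumes A: "open A" and B: "open B"
    and \<phi>: "conformal_iso A unit_disk \<phi>" and \<psi>: "conformal_iso B unit_disk \<psi>"
    and rel: "\<And>p z. p \<in> A \<Longrightarrow> \<phi> p = Fin z \<Longrightarrow> \<psi> (f p) = Fin (z ^ t)"
    and fA: "f ` A \<subseteq> B" and t: "1 \<le> t"
    and B': "open B'" "B' \<subseteq> B" and \<eta>: "conformal_iso B' unit_disk \<eta>"
    and a: "a \<in> A" "f a \<in> B'"
  obtains A' s \<phi>' \<psi>' where "open A'" "A' \<subseteq> A" "a \<in> A'" "f ` A' = B'" "s = 1 \<or> s = t"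
    "conformal_iso A' unit_disk \<phi>'" "conformal_iso B' unit_disk \<psi>'"
    "\<And>p z. p \<in> A' \<Longrightarrow> \<phi>' p = Fin z \<Longrightarrow> \<psi>' (f p) = Fin (z ^ s)"
proof -
  define \<rho> where "\<rho> = \<psi> \<circ> inv_into B' \<eta>"
  define g where "g = (\<lambda>w. coord_at (Fin 0) (\<rho> (Fin w)))"
  have disk: "Fin w \<in> unit_disk \<longleftrightarrow> w \<in> ball 0 1" for w by (auto simp: unit_disk_def)
  have diskE: "\<exists>w\<in>ball 0 1. q = Fin w" if "q \<in> unit_disk" for q using that by (auto simp: unit_disk_def)
  have \<eta>i: "conformal_iso unit_disk B' (inv_into B' \<eta>)"
    using conformal_iso_inv[OF B'(1) open_unit_disk \<eta>] .
  have \<psi>r: "conformal_iso B' (\<psi> ` B') \<psi>"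
    using conformal_iso_restrict[OF B open_unit_disk \<psi> B'(2,1)] .
  have o\<psi>: "open (\<psi> ` B')" using conformal_iso_open_image[OF open_unit_disk \<psi> B'(2,1)] .
  have \<rho>: "conformal_iso unit_disk (\<psi> ` B') \<rho>"
    unfolding \<rho>_def using conformal_iso_compose[OF open_unit_disk B'(1) o\<psi> \<eta>i \<psi>r] .
  have sub: "\<psi> ` B' \<subseteq> unit_disk" using B' conformal_iso_rules[OF \<psi>] by blast
  have \<rho>g: "\<rho> (Fin w) = Fin (g w) \<and> g w \<in> ball 0 1" if w: "w \<in> ball 0 1" for w
  proof -
    have "\<rho> (Fin w) \<in> unit_disk" using conformal_iso_rules(1)[OF \<rho>] sub w disk by blast
    then show ?thesis unfolding g_def using diskE disk by force
  qed
  have "sphere_holomorphic_on \<rho> (Fin ` ball 0 1)"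
    using conformal_isoD(4)[OF \<rho>] by (simp add: unit_disk_def)
  then have "g holomorphic_on ball 0 1"
    unfolding g_def by (rule holomorphic_on_coord) (use \<rho>g in auto)
  moreover have "inj_on g (ball 0 1)"
  proof (rule inj_onI)
    fix w w' assume w: "w \<in> ball 0 1" "w' \<in> ball 0 1" "g w = g w'"
    then have "\<rho> (Fin w) = \<rho> (Fin w')" using \<rho>g by simp
    then have "Fin w = Fin w'" using conformal_iso_rules(4)[OF \<rho>] disk w by metis
    then show "w = w'" by simp
  qed
  moreover obtain z0 where z0: "z0 \<in> ball 0 1" "\<phi> a = Fin z0"
    using diskE[OF conformal_iso_rules(1)[OF \<phi> a(1)]] by blast
  moreover have "z0 ^ t \<in> g ` ball 0 1"
  proof -
    obtain w where w: "w \<in> ball 0 1" "\<eta> (f a) = Fin w"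
      using diskE[OF conformal_iso_rules(1)[OF \<eta> a(2)]] by blast
    have "\<rho> (Fin w) = \<psi> (f a)" using conformal_iso_rules(4)[OF \<eta> a(2)] w(2) by (simp add: \<rho>_def)
    then have "Fin (g w) = Fin (z0 ^ t)" using rel[OF a(1) z0(2)] \<rho>g[OF w(1)] by simp
    then show ?thesis using w(1) by (metis imageI riemann_sphere.inject)
  qed
  ultimately obtain M G s where M: "M holomorphic_on ball 0 1" "M ` ball 0 1 = ball 0 1" "inj_on M (ball 0 1)"
    and G: "G holomorphic_on ball 0 1" "inj_on G (ball 0 1)" "z0 \<in> G ` ball 0 1" and s: "s = 1 \<or> s = t"
    and GM: "\<And>w. w \<in> ball 0 1 \<Longrightarrow> G w ^ t = g (M (w ^ s))"
    using power_lift_of_univalent[of g t z0] t by metis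
  have s1: "1 \<le> s" using s t by auto
  have pow: "w ^ s \<in> ball 0 1" if "w \<in> ball 0 1" for w :: complex
    using that norm_power_less_one_iff[OF s1] by simp
  define \<mu> where "\<mu> = sphere_lift M"
  define \<gamma> where "\<gamma> = sphere_lift G"
  define E where "E = Fin ` G ` ball 0 1"
  have \<mu>: "conformal_iso unit_disk unit_disk \<mu>"
    using conformal_iso_lift[OF M(1) open_ball M(3)] M(2) by (simp add: unit_disk_def \<mu>_def)
  have \<gamma>: "conformal_iso unit_disk E \<gamma>"
    using conformal_iso_lift[OF G(1) open_ball G(2)] by (simp add: unit_disk_def \<gamma>_def E_def)
  have "open (G ` ball 0 1)" using open_mapping_thm3[OF G(1) open_ball G(2)] .
  then have oE: "open E" unfolding E_def by (rule open_Fin_image)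
  have Esub: "E \<subseteq> unit_disk"
  proof
    fix q assume "q \<in> E"
    then obtain w where w: "w \<in> ball 0 1" "q = Fin (G w)" by (auto simp: E_def)
    have "M (w ^ s) \<in> ball 0 1" using M(2) pow[OF w(1)] by blast
    then have "norm (G w ^ t) < 1" using \<rho>g GM[OF w(1)] by simp
    then show "q \<in> unit_disk" using w(2) disk norm_power_less_one_iff[OF t] by simp
  qed
  define A' where "A' = inv_into A \<phi> ` E"
  have \<phi>i: "conformal_iso unit_disk A (inv_into A \<phi>)"
    using conformal_iso_inv[OF A open_unit_disk \<phi>] .
  have oA': "open A'" unfolding A'_def using conformal_iso_open_image[OF A \<phi>i Esub oE] .
  have A'A: "A' \<subseteq> A" unfolding A'_def using conformal_iso_rules(2)[OF \<phi>] Esub by blast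
  have "\<phi> ` A' = E"
    unfolding A'_def image_image using conformal_iso_rules(3)[OF \<phi>] Esub by force
  then have \<phi>E: "conformal_iso A' E \<phi>"
    using conformal_iso_restrict[OF A open_unit_disk \<phi> A'A oA'] by simp
  define \<phi>' where "\<phi>' = inv_into unit_disk \<gamma> \<circ> \<phi>"
  define \<psi>' where "\<psi>' = inv_into unit_disk \<mu> \<circ> \<eta>"
  have \<phi>': "conformal_iso A' unit_disk \<phi>'"
    unfolding \<phi>'_def
    using conformal_iso_compose[OF oA' oE open_unit_disk \<phi>E conformal_iso_inv[OF open_unit_disk oE \<gamma>]] .
  have \<psi>': "conformal_iso B' unit_disk \<psi>'"
    unfolding \<psi>'_def
    using conformal_iso_compose[OF B'(1) open_unit_disk open_unit_disk \<eta>
        conformal_iso_inv[OF open_unit_disk open_unit_disk \<mu>]] .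
  have key: "f p \<in> B' \<and> \<psi>' (f p) = Fin (z ^ s)" if p: "p \<in> A'" "\<phi>' p = Fin z" for p z
  proof -
    have z: "z \<in> ball 0 1" using conformal_iso_rules(1)[OF \<phi>' p(1)] p(2) disk by simp
    have "\<gamma> (\<phi>' p) = \<phi> p"
      unfolding \<phi>'_def using conformal_iso_rules(3)[OF \<gamma>] conformal_iso_rules(1)[OF \<phi>E p(1)] by simp
    then have "\<phi> p = Fin (G z)" using p(2) by (simp add: \<gamma>_def)
    then have 1: "\<psi> (f p) = Fin (G z ^ t)" using rel p(1) A'A by blast
    have Mz: "M (z ^ s) \<in> ball 0 1" using M(2) pow[OF z] by blast
    \<comment> \<open>\<open>b\<close> is the point of \<open>B'\<close> with \<psi>'-coordinate
      \<open>z ^ s\<close>. It equals \<open>f p\<close> because both have the same value under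
      \<psi>, which is injective on \<open>B\<close>.\<close>
    define b where "b = inv_into B' \<eta> (\<mu> (Fin (z ^ s)))"
    have md: "\<mu> (Fin (z ^ s)) \<in> unit_disk" using Mz disk by (simp add: \<mu>_def)
    have b: "b \<in> B'" unfolding b_def using conformal_iso_rules(2)[OF \<eta> md] .
    have "\<psi> b = \<rho> (Fin (M (z ^ s)))" by (simp add: b_def \<rho>_def \<mu>_def)
    also have "\<dots> = \<psi> (f p)" using \<rho>g[OF Mz] 1 GM[OF z] by simp
    finally have "\<psi> b = \<psi> (f p)" .
    moreover have "f p \<in> B" "b \<in> B" using p(1) A'A fA b B'(2) by auto
    ultimately have fp: "f p = b" using conformal_iso_rules(4)[OF \<psi>] by metis
    have "\<psi>' b = inv_into unit_disk \<mu> (\<mu> (Fin (z ^ s)))"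
      using conformal_iso_rules(3)[OF \<eta> md] by (simp add: \<psi>'_def b_def)
    also have "\<dots> = Fin (z ^ s)" using conformal_iso_rules(4)[OF \<mu>] pow[OF z] disk by simp
    finally show ?thesis using fp b by simp
  qed
  have "f ` A' = B'"
  proof (intro subset_antisym subsetI)
    fix q assume "q \<in> f ` A'"
    then obtain p where p: "p \<in> A'" "q = f p" by blast
    then show "q \<in> B'" using key diskE[OF conformal_iso_rules(1)[OF \<phi>' p(1)]] by blast
  next
    fix b assume b: "b \<in> B'"
    obtain w where w: "w \<in> ball 0 1" "\<psi>' b = Fin w" using diskE[OF conformal_iso_rules(1)[OF \<psi>' b]] by blast
    obtain z where z: "z \<in> ball 0 1" "z ^ s = w" using exists_unit_disk_root[OF s1 w(1)] by metis
    have zd: "Fin z \<in> unit_disk" using z disk by simp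
    define p where "p = inv_into A' \<phi>' (Fin z)"
    have p: "p \<in> A'" "\<phi>' p = Fin z"
      unfolding p_def using conformal_iso_rules(2,3)[OF \<phi>' zd] by auto
    have "f p \<in> B'" "\<psi>' (f p) = \<psi>' b" using key[OF p] z w by auto
    then have "f p = b" using conformal_iso_rules(4)[OF \<psi>'] b by metis
    then show "b \<in> f ` A'" using p by blast
  qed
  moreover have "a \<in> A'"
  proof -
    have "\<phi> a \<in> E" using z0 G(3) by (auto simp: E_def)
    then show ?thesis unfolding A'_def using conformal_iso_rules(4)[OF \<phi> a(1)] by (metis imageI)
  qed
  ultimately show thesis using that[of A' s \<phi>' \<psi>'] oA' A'A s \<phi>' \<psi>' key by blast
qed

section \<open>Plaques\<close>

lemma plaqueD:
  assumes "plaque S f d U"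
  shows "open (U i)" "U i \<subseteq> S" "f ` U (Suc i) = U i" "\<exists>\<phi>. conformal_iso (U i) unit_disk \<phi>"
    "\<exists>t \<phi> \<psi>. 1 \<le> t \<and> t \<le> d \<and>
        conformal_iso (U (Suc i)) unit_disk \<phi> \<and> conformal_iso (U i) unit_disk \<psi> \<and>
        (\<forall>p\<in>U (Suc i). \<forall>z. \<phi> p = Fin z \<longrightarrow> \<psi> (f p) = Fin (z ^ t))"
  using assms unfolding plaque_def by blast+

lemma plaque_pointsD:
  assumes "x \<in> plaque_points S f U"
  shows "x i \<in> U i" "f (x (Suc i)) = x i" "x i \<in> S" "x \<in> inverse_limit S f"
  using assms by (auto simp: plaque_points_def inverse_limit_def)

lemma in_unit_disk_iff [simp]: "Fin z \<in> unit_disk \<longleftrightarrow> norm z < 1"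
  by (auto simp: unit_disk_def)

lemma unit_diskE:
  assumes "q \<in> unit_disk" obtains z where "q = Fin z" "norm z < 1"
  using assms by (auto simp: unit_disk_def)

lemma connected_plaque:
  assumes "plaque S f d U" shows "connected (U i)"
proof -
  obtain \<phi> where \<phi>: "conformal_iso (U i) unit_disk \<phi>" using plaqueD(4)[OF assms] by blast
  have "connected unit_disk"
    unfolding unit_disk_def
    by (rule connected_continuous_image[OF continuous_on_subset[OF continuous_Fin]]) auto
  then have "connected (inv_into (U i) \<phi> ` unit_disk)"
    using connected_continuous_image conformal_isoD(3)[OF \<phi>] by blast
  moreover have "inv_into (U i) \<phi> ` unit_disk = U i"
    using conformal_iso_rules[OF \<phi>] by (intro subset_antisym subsetI) (auto, metis imageI)
  ultimately show ?thesis by simp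
qed

section \<open>Iterated images and connected preimages of plaque members\<close>

lemma plaque_funpow_image:
  assumes "plaque S f d U" shows "(f ^^ k) ` U (i + k) = U i"
proof (induction k)
  case (Suc k)
  have "(f ^^ Suc k) ` U (i + Suc k) = (f ^^ k) ` f ` U (Suc (i + k))"
    by (simp del: funpow.simps add: funpow_Suc_right image_comp)
  then show ?case using Suc plaqueD(3)[OF assms] by simp
qed simp

lemma inverse_limit_funpow:
  assumes "x \<in> inverse_limit S f" shows "(f ^^ k) (x (i + k)) = x i"
proof (induction k)
  case (Suc k)
  have "(f ^^ Suc k) (x (i + Suc k)) = (f ^^ k) (f (x (Suc (i + k))))"
    by (simp only: funpow_Suc_right o_apply add_Suc_right)
  also have "f (x (Suc (i + k))) = x (i + k)" using assms by (simp add: inverse_limit_def)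
  finally show ?case using Suc by simp
qed simp

lemma funpow_image_subset:
  assumes "f ` S \<subseteq> S" shows "(f ^^ n) ` S \<subseteq> S"
proof (induction n)
  case (Suc n)
  have "(f ^^ Suc n) ` S = f ` (f ^^ n) ` S" by (simp add: image_comp)
  also have "\<dots> \<subseteq> S" using Suc assms by blast
  finally show ?case .
qed simp

lemma continuous_on_funpow:
  assumes "continuous_on S f" "f ` S \<subseteq> S"
  shows "continuous_on S (f ^^ n)"
proof (induction n)
  case (Suc n)
  have "continuous_on S (f \<circ> (f ^^ n))"
    using Suc continuous_on_subset[OF assms(1) funpow_image_subset[OF assms(2)]]
    by (rule continuous_on_compose)
  then show ?case by simp
qed simp

text \<open>
  \<open>z \<mapsto> z\<^sup>t\<close> is proper, so \<open>W\<^sub>i\<^sub>+\<^sub>1\<close> is relatively closed, hence a whole connected component, in the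
  preimage of \<open>W\<^sub>i\<close>.
\<close>

lemma plaque_connected_subset_step:
  assumes W: "plaque S f d W" and S: "open S" "continuous_on S f"
    and C: "connected C" "C \<subseteq> S" "f ` C \<subseteq> W i" "C \<inter> W (Suc i) \<noteq> {}"
  shows "C \<subseteq> W (Suc i)"
proof -
  obtain t \<phi> \<psi> where t: "1 \<le> t" and \<phi>: "conformal_iso (W (Suc i)) unit_disk \<phi>"
    and \<psi>: "conformal_iso (W i) unit_disk \<psi>"
    and rel: "\<And>p z. p \<in> W (Suc i) \<Longrightarrow> \<phi> p = Fin z \<Longrightarrow> \<psi> (f p) = Fin (z ^ t)"
    using plaqueD(5)[OF W] by metis
  define T where "T = S \<inter> f -` W i"
  have "open (T - W (Suc i))"
  proof (subst open_subopen, intro ballI)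
    fix p assume p: "p \<in> T - W (Suc i)"
    then have fp: "f p \<in> W i" by (simp add: T_def)
    obtain z where z: "\<psi> (f p) = Fin z" "norm z < 1"
      using unit_diskE[OF conformal_iso_rules(1)[OF \<psi> fp]] by metis
    obtain r where r: "r > 0" "cball z r \<subseteq> ball 0 1"
      using open_contains_cball[of "ball (0::complex) 1"] z(2) by (metis mem_ball_0 open_ball)
    define Q where "Q = {w :: complex. w ^ t \<in> cball z r}"
    have Qd: "norm w < 1" if "w \<in> Q" for w
      using that r(2) norm_power_less_one_iff[OF t] by (auto simp: Q_def)
    have "closed Q"
      using closed_vimage[OF closed_cball[of z r] continuous_on_power[OF continuous_on_id], of t]
      by (simp add: Q_def vimage_def)
    moreover have "bounded Q" using Qd by (meson boundedI less_imp_le)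
    ultimately have "compact Q" by (simp add: compact_eq_bounded_closed)
    then have cFQ: "compact (Fin ` Q)"
      using compact_continuous_image continuous_on_subset[OF continuous_Fin] by blast
    have sub: "Fin ` Q \<subseteq> unit_disk" using Qd by auto
    \<comment> \<open>\<open>K\<close> contains every point of \<open>W (Suc i)\<close> that
      \<open>f\<close> sends into the neighbourhood \<open>V\<close> of \<open>f p\<close> defined
      below. It is compact and misses \<open>p\<close>, so removing it from the preimage of
      \<open>V\<close> leaves a neighbourhood of \<open>p\<close> disjoint from
      \<open>W (Suc i)\<close>.\<close>
    define K where "K = inv_into (W (Suc i)) \<phi> ` Fin ` Q"
    have "compact K"
      unfolding K_def using cFQ sub conformal_isoD(3)[OF \<phi>]
      by (metis compact_continuous_image continuous_on_subset)
    then have oK: "open (- K)" by (simp add: compact_imp_closed open_Compl)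
    have KW: "K \<subseteq> W (Suc i)" unfolding K_def using sub conformal_iso_rules(2)[OF \<phi>] by blast
    define V where "V = inv_into (W i) \<psi> ` Fin ` ball z r"
    have "ball z r \<subseteq> ball 0 1" using r(2) ball_subset_cball[of z r] by (rule order_trans[rotated])
    then have bsub: "Fin ` ball z r \<subseteq> unit_disk" unfolding unit_disk_def by (rule image_mono)
    have oV: "open V"
      unfolding V_def
      by (rule conformal_iso_open_image[OF plaqueD(1)[OF W]
            conformal_iso_inv[OF plaqueD(1)[OF W] open_unit_disk \<psi>] bsub]) (simp add: open_Fin_image)
    have VW: "V \<subseteq> W i" unfolding V_def using bsub conformal_iso_rules(2)[OF \<psi>] by blast
    have fpV: "f p \<in> V"
      unfolding V_def using z r(1) conformal_iso_rules(4)[OF \<psi> fp] by (metis centre_in_ball imageI)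
    have oN: "open (S \<inter> f -` V \<inter> - K)"
      using continuous_open_preimage[OF S(2,1) oV] oK by (rule open_Int)
    have pN: "p \<in> S \<inter> f -` V \<inter> - K" using p fpV KW by (auto simp: T_def)
    have "S \<inter> f -` V \<inter> - K \<subseteq> T - W (Suc i)"
    proof
      fix q assume q: "q \<in> S \<inter> f -` V \<inter> - K"
      have "q \<notin> W (Suc i)"
      proof
        assume qW: "q \<in> W (Suc i)"
        obtain w where w: "\<phi> q = Fin w" "norm w < 1"
          using unit_diskE[OF conformal_iso_rules(1)[OF \<phi> qW]] by metis
        obtain b where b: "b \<in> ball z r" "f q = inv_into (W i) \<psi> (Fin b)" using q by (auto simp: V_def)
        have "Fin b \<in> unit_disk" using b bsub by blast
        then have "\<psi> (f q) = Fin b" using b conformal_iso_rules(3)[OF \<psi>] by simp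
        then have "w ^ t = b" using rel[OF qW w(1)] by simp
        then have "w \<in> Q" using b(1) by (auto simp: Q_def)
        then have "q \<in> K" unfolding K_def using conformal_iso_rules(4)[OF \<phi> qW] w(1) by (metis imageI)
        then show False using q by simp
      qed
      then show "q \<in> T - W (Suc i)" using q VW by (auto simp: T_def)
    qed
    then show "\<exists>T'. open T' \<and> p \<in> T' \<and> T' \<subseteq> T - W (Suc i)" using oN pN by blast
  qed
  moreover have CT: "C \<subseteq> T" using C(2,3) unfolding T_def by blast
  then have "C \<subseteq> W (Suc i) \<union> (T - W (Suc i))" by blast
  ultimately have "(T - W (Suc i)) \<inter> C = {}"
    using connectedD[OF C(1) plaqueD(1)[OF W, of "Suc i"], of "T - W (Suc i)"] C(4) by blast
  then show ?thesis using CT by blast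
qed

lemma plaque_connected_subset:
  assumes W: "plaque S f d W" and S: "open S" "continuous_on S f" "f ` S \<subseteq> S"
    and x: "x \<in> plaque_points S f W"
  shows "connected C \<Longrightarrow> C \<subseteq> S \<Longrightarrow> x (n + m) \<in> C \<Longrightarrow> (f ^^ m) ` C \<subseteq> W n \<Longrightarrow> C \<subseteq> W (n + m)"
proof (induction m arbitrary: C)
  case (Suc m)
  have fC: "f ` C \<subseteq> W (n + m)"
  proof (rule Suc.IH)
    show "connected (f ` C)"
      using Suc.prems(1,2) S(2) by (metis connected_continuous_image continuous_on_subset)
    show "f ` C \<subseteq> S" using Suc.prems(2) S(3) by blast
    show "x (n + m) \<in> f ` C" using Suc.prems(3) plaque_pointsD(2)[OF x, of "n + m"] by (metis add_Suc_right imageI)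
    show "(f ^^ m) ` f ` C \<subseteq> W n" using Suc.prems(4) by (auto simp: funpow_swap1)
  qed
  have "x (n + Suc m) \<in> W (Suc (n + m))" using plaque_pointsD(1)[OF x] by simp
  then show ?case
    using plaque_connected_subset_step[OF W S(1,2) Suc.prems(1,2) fC] Suc.prems(3) by auto
qed simp

text \<open>The new bottom member is a round disk in the coordinate of \<open>U 0\<close>. Each
  further member is pulled back inside \<open>U (Suc i)\<close> around \<open>x (Suc i)\<close>, and
  its conformal map to the disk is what the next pullback requires.\<close>

lemma plaque_refine:
  assumes U: "plaque S f d U" and x: "x \<in> plaque_points S f U" and N: "open N" "x 0 \<in> N"
  obtains W where "plaque S f d W" "x \<in> plaque_points S f W" "W 0 \<subseteq> N" "\<And>i. W i \<subseteq> U i"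
proof -
  define P where "P i V \<longleftrightarrow> open V \<and> V \<subseteq> U i \<and> x i \<in> V \<and> (\<exists>\<eta>. conformal_iso V unit_disk \<eta>)
    \<and> (i = 0 \<longrightarrow> V \<subseteq> N)" for i V
  define R where "R B A \<longleftrightarrow> f ` A = B \<and> (\<exists>t \<phi> \<psi>. 1 \<le> t \<and> t \<le> d \<and>
        conformal_iso A unit_disk \<phi> \<and> conformal_iso B unit_disk \<psi> \<and>
        (\<forall>p\<in>A. \<forall>z. \<phi> p = Fin z \<longrightarrow> \<psi> (f p) = Fin (z ^ t)))" for A B
  have "\<exists>W. \<forall>i. P i (W i) \<and> R (W i) (W (Suc i))"
  proof (rule dependent_nat_choice)
    obtain \<psi> where \<psi>: "conformal_iso (U 0) unit_disk \<psi>" using plaqueD(4)[OF U] by blast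
    have oV: "open (\<psi> ` (N \<inter> U 0))"
      by (rule conformal_iso_open_image[OF open_unit_disk \<psi>]) (use N plaqueD(1)[OF U] in auto)
    obtain z where z: "\<psi> (x 0) = Fin z" "norm z < 1"
      using unit_diskE[OF conformal_iso_rules(1)[OF \<psi> plaque_pointsD(1)[OF x]]] by metis
    have "open (Fin -` \<psi> ` (N \<inter> U 0))" using oV by (simp add: open_riemann_sphere_def)
    moreover have "z \<in> Fin -` \<psi> ` (N \<inter> U 0)"
      using z N(2) plaque_pointsD(1)[OF x, of 0] by (metis IntI imageI vimageI)
    ultimately obtain r where r: "r > 0" "ball z r \<subseteq> Fin -` \<psi> ` (N \<inter> U 0)" by (meson openE)
    have b: "Fin ` ball z r \<subseteq> \<psi> ` (N \<inter> U 0)" using r(2) by blast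
    have "\<psi> ` (N \<inter> U 0) \<subseteq> unit_disk"
      using conformal_iso_rules(1)[OF \<psi>] by (simp add: image_subset_iff)
    with b have bd: "Fin ` ball z r \<subseteq> unit_disk" by (rule order_trans)
    have ob: "open (Fin ` ball z r)" by (simp add: open_Fin_image)
    define D where "D = inv_into (U 0) \<psi> ` Fin ` ball z r"
    have \<psi>i: "conformal_iso unit_disk (U 0) (inv_into (U 0) \<psi>)"
      by (rule conformal_iso_inv[OF plaqueD(1)[OF U] open_unit_disk \<psi>])
    have oD: "open D" unfolding D_def by (rule conformal_iso_open_image[OF plaqueD(1)[OF U] \<psi>i bd ob])
    have DN: "D \<subseteq> N \<inter> U 0"
    proof
      fix q assume "q \<in> D"
      then obtain w where w: "w \<in> ball z r" "q = inv_into (U 0) \<psi> (Fin w)" by (auto simp: D_def)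
      then obtain p where p: "p \<in> N \<inter> U 0" "Fin w = \<psi> p" using b by blast
      then show "q \<in> N \<inter> U 0" using w conformal_iso_rules(4)[OF \<psi>] by simp
    qed
    have xD: "x 0 \<in> D"
      unfolding D_def using z r(1) conformal_iso_rules(4)[OF \<psi> plaque_pointsD(1)[OF x]]
      by (metis centre_in_ball imageI)
    have c1: "conformal_iso (Fin ` ball z r) D (inv_into (U 0) \<psi>)"
      unfolding D_def by (rule conformal_iso_restrict[OF open_unit_disk plaqueD(1)[OF U] \<psi>i bd ob])
    \<comment> \<open>An affine map identifies the unit disk with \<open>ball z r\<close>, so that
      the smaller disk is again conformally a unit disk.\<close>
    define h where "h w = z + of_real r * w" for w
    have "h ` ball 0 1 = ball z r"
    proof (intro subset_antisym subsetI)
      fix w assume "w \<in> ball z r"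
      then have "(w - z) / of_real r \<in> ball 0 1" "w = h ((w - z) / of_real r)"
        using r(1) by (auto simp: h_def dist_norm norm_divide norm_minus_commute)
      then show "w \<in> h ` ball 0 1" by blast
    qed (use r(1) in \<open>auto simp: h_def dist_norm norm_mult\<close>)
    moreover have "conformal_iso (Fin ` ball 0 1) (Fin ` h ` ball 0 1) (sphere_lift h)"
      by (rule conformal_iso_lift)
         (use r(1) in \<open>auto simp: h_def[abs_def] inj_on_def intro!: holomorphic_intros\<close>)
    ultimately have c0: "conformal_iso unit_disk (Fin ` ball z r) (sphere_lift h)"
      by (simp add: unit_disk_def)
    have "conformal_iso unit_disk D (inv_into (U 0) \<psi> \<circ> sphere_lift h)"
      by (rule conformal_iso_compose[OF open_unit_disk ob oD c0 c1])
    then have "\<exists>\<eta>. conformal_iso D unit_disk \<eta>"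
      using conformal_iso_inv[OF open_unit_disk oD] by blast
    then have "P 0 D" using oD DN xD by (auto simp: P_def)
    then show "\<exists>V. P 0 V" by blast
  next
    fix B i assume P: "P i B"
    obtain t \<phi> \<psi> where t: "1 \<le> t" "t \<le> d" and \<phi>: "conformal_iso (U (Suc i)) unit_disk \<phi>"
      and \<psi>: "conformal_iso (U i) unit_disk \<psi>"
      and rel: "\<And>p z. p \<in> U (Suc i) \<Longrightarrow> \<phi> p = Fin z \<Longrightarrow> \<psi> (f p) = Fin (z ^ t)"
      using plaqueD(5)[OF U] by metis
    obtain \<eta> where B: "open B" "B \<subseteq> U i" "x i \<in> B" "conformal_iso B unit_disk \<eta>"
      using P by (auto simp: P_def)
    have fx: "f (x (Suc i)) \<in> B" using B plaque_pointsD(2)[OF x] by simp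
    obtain A s \<phi>' \<psi>' where A: "open A" "A \<subseteq> U (Suc i)" "x (Suc i) \<in> A" "f ` A = B" "s = 1 \<or> s = t"
      "conformal_iso A unit_disk \<phi>'" "conformal_iso B unit_disk \<psi>'"
      "\<And>p z. p \<in> A \<Longrightarrow> \<phi>' p = Fin z \<Longrightarrow> \<psi>' (f p) = Fin (z ^ s)"
      using pullback_power_disk[where f = f, OF plaqueD(1)[OF U] plaqueD(1)[OF U] \<phi> \<psi> rel _ t(1) B(1,2,4)
          plaque_pointsD(1)[OF x] fx] plaqueD(3)[OF U, of i] by (metis subset_refl)
    have "1 \<le> s" "s \<le> d" using A(5) t by auto
    then have "R B A" unfolding R_def using A by blast
    moreover have "P (Suc i) A" unfolding P_def using A by blast
    ultimately show "\<exists>A. P (Suc i) A \<and> R B A" by blast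
  qed
  then obtain W where W: "\<And>i. P i (W i)" "\<And>i. R (W i) (W (Suc i))" by blast
  have "plaque S f d W"
    unfolding plaque_def
  proof (intro conjI allI)
    fix i
    show "open (W i)" using W(1)[of i] by (simp add: P_def)
    show "W i \<subseteq> S" using W(1)[of i] plaqueD(2)[OF U, of i] by (auto simp: P_def)
    show "f ` W (Suc i) = W i" using W(2)[of i] by (simp add: R_def)
    show "\<exists>\<phi>. conformal_iso (W i) unit_disk \<phi>" using W(1)[of i] by (simp add: P_def)
    show "\<exists>t \<phi> \<psi>. 1 \<le> t \<and> t \<le> d \<and> conformal_iso (W (Suc i)) unit_disk \<phi> \<and>
        conformal_iso (W i) unit_disk \<psi> \<and>
        (\<forall>p\<in>W (Suc i). \<forall>z. \<phi> p = Fin z \<longrightarrow> \<psi> (f p) = Fin (z ^ t))"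
      using W(2)[of i] by (simp add: R_def)
  qed
  moreover have "x \<in> plaque_points S f W"
    using W(1) plaque_pointsD(4)[OF x] by (auto simp: plaque_points_def P_def)
  ultimately show thesis using that[of W] W(1) by (simp add: P_def)
qed

text \<open>Since the fibre of \<open>f ^^ i\<close> over \<open>x 0\<close> is finite, a small
  circle around \<open>x i\<close> misses it. The image of the circle is compact and avoids
  \<open>x 0\<close>, so the bottom member can be chosen off this image; then \<open>W i\<close>
  cannot meet the circle.\<close>

lemma plaque_refine_at:
  assumes U: "plaque S f d U" and x: "x \<in> plaque_points S f U" and N: "open N" "x i \<in> N"
    and S: "continuous_on S f" "f ` S \<subseteq> S" and fin: "finite {p \<in> S. (f ^^ i) p = x 0}"
  obtains W where "plaque S f d W" "x \<in> plaque_points S f W" "W i \<subseteq> N"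
proof -
  obtain \<psi> where \<psi>: "conformal_iso (U i) unit_disk \<psi>" using plaqueD(4)[OF U] by blast
  have xU: "x i \<in> U i" using plaque_pointsD(1)[OF x] .
  obtain z where z: "\<psi> (x i) = Fin z" "norm z < 1"
    using unit_diskE[OF conformal_iso_rules(1)[OF \<psi> xU]] by metis
  \<comment> \<open>The other points of the fibre. Removing them makes \<open>x i\<close> the only
    point of \<open>V\<close> over \<open>x 0\<close>.\<close>
  define F where "F = {p \<in> U i. (f ^^ i) p = x 0} - {x i}"
  have "F \<subseteq> {p \<in> S. (f ^^ i) p = x 0}" using plaqueD(2)[OF U, of i] by (auto simp: F_def)
  then have finF: "finite F" using fin finite_subset by blast
  define V where "V = N \<inter> U i - F"
  have oV: "open V" unfolding V_def using N plaqueD(1)[OF U] finF by (intro open_Diff finite_imp_closed) auto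
  have VU: "V \<subseteq> U i" by (auto simp: V_def)
  have "open (\<psi> ` V)" by (rule conformal_iso_open_image[OF open_unit_disk \<psi> VU oV])
  then have "open (Fin -` \<psi> ` V)" by (simp add: open_riemann_sphere_def)
  moreover have "x i \<in> V" using N xU by (simp add: V_def F_def)
  then have "z \<in> Fin -` \<psi> ` V" using z by (metis imageI vimageI)
  ultimately obtain r where r: "r > 0" "cball z r \<subseteq> Fin -` \<psi> ` V" by (meson open_contains_cball)
  have cV: "p \<in> V" if "p \<in> U i" "\<psi> p = Fin w" "w \<in> cball z r" for p w
  proof -
    obtain q where q: "q \<in> V" "Fin w = \<psi> q" using r(2) \<open>w \<in> cball z r\<close> by blast
    then show ?thesis using conformal_iso_rules(4)[OF \<psi>] that(1,2) VU by (metis subsetD)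
  qed
  have "Fin ` cball z r \<subseteq> \<psi> ` V" using r(2) by (simp add: image_subset_iff_subset_vimage)
  moreover have "\<psi> ` V \<subseteq> unit_disk"
    using conformal_iso_rules(1)[OF \<psi>] subsetD[OF VU] by (simp add: image_subset_iff)
  ultimately have cd: "Fin ` cball z r \<subseteq> unit_disk" by (rule order_trans)
  define K where "K = inv_into (U i) \<psi> ` Fin ` sphere z r"
  have sd: "Fin ` sphere z r \<subseteq> unit_disk"
    using cd sphere_cball[of z r] by (metis image_mono order_trans)
  have KU: "K \<subseteq> U i" unfolding K_def using sd conformal_iso_rules(2)[OF \<psi>] by blast
  have "compact (Fin ` sphere z r)"
    by (rule compact_continuous_image[OF continuous_on_subset[OF continuous_Fin]]) auto
  then have "compact K"
    unfolding K_def using sd conformal_isoD(3)[OF \<psi>]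
    by (metis compact_continuous_image continuous_on_subset)
  moreover have "continuous_on K (f ^^ i)"
    using continuous_on_funpow[OF S] KU plaqueD(2)[OF U, of i] by (metis continuous_on_subset order_trans)
  ultimately have "compact ((f ^^ i) ` K)" by (metis compact_continuous_image)
  then have oN: "open (- (f ^^ i) ` K)" by (simp add: compact_imp_closed open_Compl)
  have "x 0 \<notin> (f ^^ i) ` K"
  proof
    assume "x 0 \<in> (f ^^ i) ` K"
    then obtain w where w: "w \<in> sphere z r" "(f ^^ i) (inv_into (U i) \<psi> (Fin w)) = x 0"
      by (auto simp: K_def)
    define p where "p = inv_into (U i) \<psi> (Fin w)"
    have "Fin w \<in> unit_disk" using w sd by blast
    then have p: "p \<in> U i" "\<psi> p = Fin w" using conformal_iso_rules(2,3)[OF \<psi>] by (auto simp: p_def)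
    have "p \<in> V" by (rule cV[OF p]) (use w in auto)
    then have "p \<notin> F" by (simp add: V_def)
    then have "p = x i" using w p by (simp add: F_def p_def)
    then have "w = z" using p z by simp
    then show False using w(1) r(1) by simp
  qed
  then have xN: "x 0 \<in> - (f ^^ i) ` K" by simp
  obtain W where W: "plaque S f d W" "x \<in> plaque_points S f W" "W 0 \<subseteq> - (f ^^ i) ` K" "\<And>j. W j \<subseteq> U j"
    using plaque_refine[OF U x oN xN] by metis
  \<comment> \<open>The plane picture of \<open>W i\<close>: connected and containing
    \<open>z\<close>. A point of it on the circle would come from \<open>K\<close> and have its
    image in \<open>W 0\<close>, which avoids the image of \<open>K\<close>.\<close>
  define C where "C = coord_at (Fin 0) ` \<psi> ` W i"
  have \<psi>W: "\<psi> ` W i \<subseteq> unit_disk" using W(4) conformal_iso_rules(1)[OF \<psi>] by blast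
  have "connected (\<psi> ` W i)"
    using connected_plaque[OF W(1)] conformal_isoD(2)[OF \<psi>] W(4)
    by (metis connected_continuous_image continuous_on_subset)
  moreover have "\<psi> ` W i \<subseteq> range Fin" using \<psi>W by (auto simp: unit_disk_def)
  ultimately have "connected C"
    unfolding C_def using continuous_on_the_Fin by (metis connected_continuous_image continuous_on_subset)
  moreover have "z \<in> C" unfolding C_def using plaque_pointsD(1)[OF W(2)] z(1)
    by (metis coord_param image_eqI param_at.simps(1) add_0)
  moreover have "C \<inter> frontier (ball z r) = {}"
  proof (rule ccontr)
    assume "C \<inter> frontier (ball z r) \<noteq> {}"
    then obtain p where p: "p \<in> W i" "coord_at (Fin 0) (\<psi> p) \<in> sphere z r"
      unfolding C_def frontier_ball[OF r(1)] by blast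
    have pU: "p \<in> U i" using p W(4) by blast
    obtain w where w: "\<psi> p = Fin w" using unit_diskE[OF conformal_iso_rules(1)[OF \<psi> pU]] by metis
    then have "p = inv_into (U i) \<psi> (Fin w)" "w \<in> sphere z r"
      using conformal_iso_rules(4)[OF \<psi> pU] p by auto
    then have "p \<in> K" by (auto simp: K_def)
    then show False using plaque_funpow_image[OF W(1), of i 0] W(3) p(1) by auto
  qed
  ultimately have CB: "C \<subseteq> ball z r"
    using connected_Int_frontier[of C "ball z r"] r(1) by (metis Diff_eq_empty_iff IntI centre_in_ball empty_iff)
  have "W i \<subseteq> N"
  proof
    fix p assume p: "p \<in> W i"
    have pU: "p \<in> U i" using p W(4) by blast
    obtain w where w: "\<psi> p = Fin w" using unit_diskE[OF conformal_iso_rules(1)[OF \<psi> pU]] by metis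
    have "coord_at (Fin 0) (\<psi> p) \<in> C" using p unfolding C_def by blast
    then have "w \<in> ball z r" using CB w by auto
    then have "p \<in> V" using cV[OF pU w] by simp
    then show "p \<in> N" by (simp add: V_def)
  qed
  then show thesis using that W(1,2) by blast
qed

section \<open>Inverse-critical sets\<close>

lemma finite_fibre_funpow:
  assumes "f ` S \<subseteq> S" "\<And>q. q \<in> S \<Longrightarrow> finite {p \<in> S. f p = q}" "q \<in> S"
  shows "finite {p \<in> S. (f ^^ n) p = q}"
proof (induction n)
  case (Suc n)
  have "{p \<in> S. (f ^^ Suc n) p = q} \<subseteq> (\<Union>r\<in>{r \<in> S. (f ^^ n) r = q}. {p \<in> S. f p = r})"
    using assms(1) by (auto simp del: funpow.simps simp add: funpow_Suc_right)
  moreover have "finite (\<Union>r\<in>{r \<in> S. (f ^^ n) r = q}. {p \<in> S. f p = r})"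
    using Suc assms(2) by (intro finite_UN_I) auto
  ultimately show ?case by (rule finite_subset)
qed (use assms in auto)

text \<open>A countable decreasing base at \<open>p\<close>, over which the choices of times and
  preimages below run.\<close>

lemma param_ball_nested:
  assumes "open W" "p \<in> W"
  obtains N where "\<And>k. k \<ge> N \<Longrightarrow> param_at p ` ball 0 (inverse (real (Suc k))) \<subseteq> W"
proof -
  obtain r where r: "r > 0" "param_at p ` ball 0 r \<subseteq> W" using param_ball_base[OF assms] by metis
  obtain N where N: "inverse (real (Suc N)) < r" using reals_Archimedean[OF r(1)] by blast
  have "param_at p ` ball 0 (inverse (real (Suc k))) \<subseteq> W" if "k \<ge> N" for k
  proof -
    have "inverse (real (Suc k)) \<le> inverse (real (Suc N))" using that by (simp add: le_imp_inverse_le)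
    then have "inverse (real (Suc k)) \<le> r" using N by linarith
    then have "ball (0::complex) (inverse (real (Suc k))) \<subseteq> ball 0 r" by (rule subset_ball)
    then show ?thesis using r(2) image_mono order_trans by metis
  qed
  then show thesis using that by metis
qed

lemma connected_component_set_mono_mem:
  "A \<subseteq> B \<Longrightarrow> c \<in> connected_component_set A y \<Longrightarrow> c \<in> connected_component_set B y"
  using connected_component_mono by (rule subsetD)

lemma mem_param_ball: "p \<in> param_at p ` ball 0 (inverse (real (Suc k)))"
  by (metis centre_in_ball image_eqI inverse_positive_iff_positive of_nat_0_less_iff param_zero zero_less_Suc)

lemma omega_limitI:
  assumes "p \<in> S" and inf: "\<And>W. open W \<Longrightarrow> p \<in> W \<Longrightarrow> infinite {n. (f ^^ n) c \<in> W}"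
  shows "p \<in> omega_limit S f c"
proof -
  define B where "B k = param_at p ` ball 0 (inverse (real (Suc k)))" for k
  have B: "\<exists>n>m. (f ^^ n) c \<in> B k" for m k
  proof -
    have "infinite {n. (f ^^ n) c \<in> B k}"
      by (rule inf) (simp_all only: B_def mem_param_ball open_param_image open_ball)
    then show ?thesis by (auto simp: infinite_nat_iff_unbounded)
  qed
  have "\<exists>k. \<forall>t. (0 < k t \<and> (f ^^ k t) c \<in> B t) \<and> k t < k (Suc t)"
  proof (rule dependent_nat_choice)
    show "\<exists>n. 0 < n \<and> (f ^^ n) c \<in> B 0" using B by blast
    fix n t :: nat
    obtain n' where "n' > n" "(f ^^ n') c \<in> B (Suc t)" using B by blast
    then show "\<exists>n'. (0 < n' \<and> (f ^^ n') c \<in> B (Suc t)) \<and> n < n'" by (intro exI[of _ n']) simp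
  qed
  then obtain k :: "nat \<Rightarrow> nat" where k: "\<And>t. 0 < k t" "\<And>t. (f ^^ k t) c \<in> B t" "\<And>t. k t < k (Suc t)"
    by blast
  have "(\<lambda>t. (f ^^ k t) c) \<longlonglongrightarrow> p"
  proof (rule topological_tendstoI)
    fix W assume "open W" "p \<in> W"
    then obtain N where "\<And>t. t \<ge> N \<Longrightarrow> B t \<subseteq> W" using param_ball_nested unfolding B_def by metis
    then show "\<forall>\<^sub>F t in sequentially. (f ^^ k t) c \<in> W"
      using k(2) unfolding eventually_sequentially by (metis subsetD)
  qed
  moreover have "strict_mono k" using k(3) by (simp add: strict_mono_Suc_iff)
  ultimately show ?thesis using k(1) \<open>p \<in> S\<close> unfolding omega_limit_def by blast
qed

lemma omega_limit_image:
  assumes "open S" "continuous_on S f" "f ` S \<subseteq> S" "p \<in> omega_limit S f c"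
  shows "f p \<in> omega_limit S f c"
proof -
  obtain k :: "nat \<Rightarrow> nat" where p: "p \<in> S" and k: "strict_mono k" "(\<lambda>t. (f ^^ k t) c) \<longlonglongrightarrow> p"
    using assms(4) by (auto simp: omega_limit_def)
  have "isCont f p" using assms(1,2) p by (simp add: continuous_on_eq_continuous_at)
  then have "(\<lambda>t. f ((f ^^ k t) c)) \<longlonglongrightarrow> f p" using k(2) by (rule isCont_tendsto_compose)
  then have "(\<lambda>t. (f ^^ Suc (k t)) c) \<longlonglongrightarrow> f p" by simp
  moreover have "strict_mono (\<lambda>t. Suc (k t))" using k(1) by (simp add: strict_mono_def)
  moreover have "f p \<in> S" using p assms(3) by blast
  ultimately show ?thesis
    unfolding omega_limit_def by (intro CollectI conjI exI[of _ "\<lambda>t. Suc (k t)"]) simp_all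
qed

text \<open>Simply connected neighbourhoods suffice, as they form a base.\<close>

lemma inverse_criticalD:
  assumes V: "inverse_critical S f c V" and "z \<in> V" "open S" "open W" "z \<in> W"
  obtains n y where "n \<ge> 1" "y \<in> V" "(f ^^ n) y = z"
    "c \<in> connected_component_set {p \<in> S. (f ^^ n) p \<in> W} y"
proof -
  have "z \<in> S" using V \<open>z \<in> V\<close> by (auto simp: inverse_critical_def omega_limit_def)
  then obtain r where r: "r > 0" "param_at z ` ball 0 r \<subseteq> W \<inter> S"
    using param_ball_base[of "W \<inter> S" z] assms by (metis IntI open_Int)
  define D where "D = param_at z ` ball 0 r"
  have "open D" "simply_connected D"
    unfolding D_def by (simp_all only: open_param_image open_ball simply_connected_param_ball)
  moreover have "z \<in> D" unfolding D_def using r(1) by (metis centre_in_ball image_eqI param_zero)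
  moreover have "D \<subseteq> S" "D \<subseteq> W" using r(2) by (auto simp: D_def)
  ultimately obtain n y where ny: "n \<ge> 1" "y \<in> V" "(f ^^ n) y = z"
    "c \<in> connected_component_set {p \<in> S. (f ^^ n) p \<in> D} y"
    using V \<open>z \<in> V\<close> unfolding inverse_critical_def by metis
  have "{p \<in> S. (f ^^ n) p \<in> D} \<subseteq> {p \<in> S. (f ^^ n) p \<in> W}" using \<open>D \<subseteq> W\<close> by blast
  then have "c \<in> connected_component_set {p \<in> S. (f ^^ n) p \<in> W} y"
    using ny(4) by (rule connected_component_set_mono_mem)
  then show thesis by (rule that[OF ny(1-3)])
qed

text \<open>A point of the union takes its witness \<open>y\<close> from the inverse-critical set it
  came from.\<close>

lemma inverse_critical_Gamma_set: "inverse_critical S f c (Gamma_set S f c)"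
  unfolding inverse_critical_def
proof (intro conjI ballI allI impI)
  show "Gamma_set S f c \<subseteq> omega_limit S f c" by (auto simp: Gamma_set_def inverse_critical_def)
  fix z U assume "z \<in> Gamma_set S f c" and U: "open U \<and> U \<subseteq> S \<and> simply_connected U \<and> z \<in> U"
  then obtain V where V: "inverse_critical S f c V" "z \<in> V" by (auto simp: Gamma_set_def)
  then obtain n y where "n \<ge> 1" "y \<in> V" "(f ^^ n) y = z"
      "c \<in> connected_component_set {p \<in> S. (f ^^ n) p \<in> U} y"
    using U unfolding inverse_critical_def by metis
  moreover have "V \<subseteq> Gamma_set S f c" using V(1) by (auto simp: Gamma_set_def)
  ultimately show "\<exists>n\<ge>1. \<exists>y\<in>Gamma_set S f c. (f ^^ n) y = z \<and>
      c \<in> connected_component_set {p \<in> S. (f ^^ n) p \<in> U} y" by blast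
qed

text \<open>For a new point \<open>f w\<close>, the condition at \<open>w\<close> is applied to the
  preimage of the neighbourhood under \<open>f\<close>; its witness reaches \<open>f w\<close> one
  iterate later. Through this, \<Gamma>(c) is forward invariant.\<close>

lemma inverse_critical_Un_image:
  assumes S: "open S" "continuous_on S f" "f ` S \<subseteq> S" and V: "inverse_critical S f c V"
  shows "inverse_critical S f c (V \<union> f ` V)"
  unfolding inverse_critical_def
proof (intro conjI ballI allI impI)
  have \<omega>: "V \<subseteq> omega_limit S f c" using V by (simp add: inverse_critical_def)
  then show "V \<union> f ` V \<subseteq> omega_limit S f c" using omega_limit_image[OF S] by blast
  fix z U assume z: "z \<in> V \<union> f ` V" and U: "open U \<and> U \<subseteq> S \<and> simply_connected U \<and> z \<in> U"
  show "\<exists>n\<ge>1. \<exists>y\<in>V \<union> f ` V. (f ^^ n) y = z \<and> c \<in> connected_component_set {p \<in> S. (f ^^ n) p \<in> U} y"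
  proof (cases "z \<in> V")
    case True
    then show ?thesis using V U unfolding inverse_critical_def by (metis UnI1)
  next
    case False
    then obtain w where w: "w \<in> V" "z = f w" using z by blast
    have oW: "open (S \<inter> f -` U)" using continuous_open_preimage[OF S(2,1)] U by blast
    have wW: "w \<in> S \<inter> f -` U" using w \<omega> U by (auto simp: omega_limit_def)
    obtain n y where ny: "n \<ge> 1" "y \<in> V" "(f ^^ n) y = w"
        "c \<in> connected_component_set {p \<in> S. (f ^^ n) p \<in> S \<inter> f -` U} y"
      by (rule inverse_criticalD[OF V w(1) S(1) oW wW])
    have "{p \<in> S. (f ^^ n) p \<in> S \<inter> f -` U} \<subseteq> {p \<in> S. (f ^^ Suc n) p \<in> U}" by auto
    then have "c \<in> connected_component_set {p \<in> S. (f ^^ Suc n) p \<in> U} y"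
      using ny(4) by (rule connected_component_set_mono_mem)
    moreover have "(f ^^ Suc n) y = z" using ny(3) w(2) by simp
    moreover have "Suc n \<ge> 1" by simp
    ultimately show ?thesis using ny(2) by blast
  qed
qed

lemma Gamma_set_image:
  assumes "open S" "continuous_on S f" "f ` S \<subseteq> S" "z \<in> Gamma_set S f c"
  shows "f z \<in> Gamma_set S f c"
proof -
  obtain V where V: "inverse_critical S f c V" "z \<in> V" using assms(4) by (auto simp: Gamma_set_def)
  then have "inverse_critical S f c (V \<union> f ` V)" using inverse_critical_Un_image assms by metis
  then show ?thesis using V(2) unfolding Gamma_set_def by blast
qed

lemma Gamma_set_subset: "Gamma_set S f c \<subseteq> S"
  by (auto simp: Gamma_set_def inverse_critical_def omega_limit_def)

text \<open>Inverse-criticality gives preimages only at some depths \<open>m k\<close>. The levels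
  between are filled by iterating \<open>f\<close> downwards and stay in \<Gamma>(c) by forward
  invariance. The component condition refers to the whole iterate from \<open>x (m k)\<close> down
  to \<open>z\<close>, as the comparison with plaque members needs.\<close>

lemma Gamma_set_backward_orbit:
  assumes S: "open S" "continuous_on S f" "f ` S \<subseteq> S" and z: "z \<in> Gamma_set S f c"
  obtains x m where "x \<in> invariant_lift S f (Gamma_set S f c)" "x 0 = z" "strict_mono m"
    "\<forall>W. open W \<and> z \<in> W \<longrightarrow>
       (\<forall>\<^sub>F k in sequentially. c \<in> connected_component_set {p \<in> S. (f ^^ m k) p \<in> W} (x (m k)))"
proof -
  let ?G = "Gamma_set S f c"
  define B where "B k = param_at z ` ball 0 (inverse (real (Suc k)))" for k
  have oB: "open (B k)" and zB: "z \<in> B k" for k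
    by (simp_all only: B_def mem_param_ball open_param_image open_ball)
  \<comment> \<open>A state is a pair: the depth below which \<open>z\<close> lies in the orbit, and
    the preimage of \<open>z\<close> at that depth.\<close>
  define P where "P s \<longleftrightarrow> snd s \<in> ?G \<and> (f ^^ fst s) (snd s) = z" for s
  define R where "R k s s' \<longleftrightarrow> fst s < fst s' \<and> (f ^^ (fst s' - fst s)) (snd s') = snd s \<and>
     c \<in> connected_component_set {p \<in> S. (f ^^ fst s') p \<in> B k} (snd s')" for k s s'
  have "\<exists>s. \<forall>k. P (s k) \<and> R k (s k) (s (Suc k))"
  proof (rule dependent_nat_choice)
    have "P (0, z)" using z by (simp add: P_def)
    then show "\<exists>s. P s" by blast
    fix s k assume "P s"
    then have s: "snd s \<in> ?G \<and> (f ^^ fst s) (snd s) = z" by (simp add: P_def)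
    \<comment> \<open>Pulling \<open>B k\<close> back to the current point turns a component
      condition for \<open>n\<close> further iterates into one for the total depth
      \<open>fst s + n\<close>.\<close>
    define W where "W = S \<inter> (f ^^ fst s) -` B k"
    have oW: "open W"
      unfolding W_def using continuous_open_preimage[OF continuous_on_funpow[OF S(2,3)] S(1) oB] .
    have sW: "snd s \<in> W" 
      using s zB subsetD[OF Gamma_set_subset[of S f c], of "snd s"] by (simp add: W_def)
    obtain n y where ny: "n \<ge> 1" "y \<in> ?G" "(f ^^ n) y = snd s"
      "c \<in> connected_component_set {p \<in> S. (f ^^ n) p \<in> W} y"
      by (rule inverse_criticalD[OF inverse_critical_Gamma_set conjunct1[OF s] S(1) oW sW])
    have "{p \<in> S. (f ^^ n) p \<in> W} \<subseteq> {p \<in> S. (f ^^ (fst s + n)) p \<in> B k}"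
      by (auto simp: W_def funpow_add)
    then have "c \<in> connected_component_set {p \<in> S. (f ^^ (fst s + n)) p \<in> B k} y"
      using ny(4) by (rule connected_component_set_mono_mem)
    moreover have "(f ^^ (fst s + n)) y = z" using ny(3) s by (simp add: funpow_add)
    ultimately have "P (fst s + n, y)" "R k s (fst s + n, y)" using ny by (simp_all add: P_def R_def)
    then show "\<exists>s'. P s' \<and> R k s s'" by blast
  qed
  then obtain s where PR: "\<And>k. P (s k)" "\<And>k. R k (s k) (s (Suc k))" by blast
  have s: "snd (s k) \<in> ?G" "(f ^^ fst (s k)) (snd (s k)) = z" "fst (s k) < fst (s (Suc k))"
    "(f ^^ (fst (s (Suc k)) - fst (s k))) (snd (s (Suc k))) = snd (s k)"
    "c \<in> connected_component_set {p \<in> S. (f ^^ fst (s (Suc k))) p \<in> B k} (snd (s (Suc k)))" for k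
    using PR(1)[of k] PR(2)[of k] unfolding P_def R_def by simp_all
  define m where "m k = fst (s k)" for k
  define y where "y k = snd (s k)" for k
  have mono: "strict_mono m" using s(3) by (simp add: strict_mono_Suc_iff m_def)
  have mge: "k \<le> m k" for k using mono by (rule strict_mono_imp_increasing)
  have descend: "(f ^^ (m (j + k) - i)) (y (j + k)) = (f ^^ (m j - i)) (y j)" if "i \<le> m j" for i j k
  proof (induction k)
    case (Suc k)
    have "m j \<le> m (j + k)" using mono by (simp add: strict_mono_less_eq)
    moreover have "m (j + k) < m (Suc (j + k))" using s(3) by (simp add: m_def)
    ultimately have "m (Suc (j + k)) - i = (m (j + k) - i) + (m (Suc (j + k)) - m (j + k))"
      using that by simp
    then have "(f ^^ (m (Suc (j + k)) - i)) (y (Suc (j + k)))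
        = (f ^^ (m (j + k) - i)) ((f ^^ (m (Suc (j + k)) - m (j + k))) (y (Suc (j + k))))"
      by (simp only: funpow_add o_apply)
    also have "\<dots> = (f ^^ (m (j + k) - i)) (y (j + k))" using s(4) by (simp add: m_def y_def)
    finally show ?case using Suc by simp
  qed simp
  \<comment> \<open>\<open>y i\<close> lies at depth \<open>m i\<close>, which is at least
    \<open>i\<close>; any \<open>y j\<close> at depth at least \<open>i\<close> would give the same
    value.\<close>
  define x where "x i = (f ^^ (m i - i)) (y i)" for i
  have xeq: "x i = (f ^^ (m j - i)) (y j)" if ij: "i \<le> m j" for i j
  proof (cases "i \<le> j")
    case True
    then obtain k where "j = i + k" using le_Suc_ex by blast
    then show ?thesis using descend[of i i k] mge by (simp add: x_def)
  next
    case False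
    then obtain k where "i = j + k" using le_Suc_ex nat_le_linear by metis
    then show ?thesis using descend[OF ij, of k] by (simp add: x_def)
  qed
  have xf: "f (x (Suc i)) = x i" for i
  proof -
    have "i \<le> m (Suc i)" "m (Suc i) - i = Suc (m (Suc i) - Suc i)" using mge[of "Suc i"] by auto
    then show ?thesis using xeq[of i "Suc i"] by (simp add: x_def)
  qed
  have xm: "x (m k) = y k" for k using xeq[of "m k" k] by simp
  have iter: "(f ^^ n) w \<in> ?G" if "w \<in> ?G" for n w
    by (induction n) (use that Gamma_set_image[OF S] in auto)
  have xG: "x i \<in> ?G" for i unfolding x_def y_def using iter s(1) by blast
  show thesis
  proof (rule that[of x m])
    show "x \<in> invariant_lift S f ?G"
      using xG xf subsetD[OF Gamma_set_subset xG] by (simp add: invariant_lift_def inverse_limit_def)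
    show "x 0 = z" using s(2)[of 0] by (simp add: x_def m_def y_def)
    show "strict_mono m" by (rule mono)
    have "\<forall>\<^sub>F k in sequentially. c \<in> connected_component_set {p \<in> S. (f ^^ m k) p \<in> W} (x (m k))"
      if W: "open W" "z \<in> W" for W
    proof -
      obtain N where N: "\<And>k. k \<ge> N \<Longrightarrow> B k \<subseteq> W" using param_ball_nested[OF W] unfolding B_def by metis
      \<comment> \<open>The shift by one arises because \<open>B j\<close> controls the step that
        produces state \<open>Suc j\<close>.\<close>
      have "c \<in> connected_component_set {p \<in> S. (f ^^ m k) p \<in> W} (x (m k))" if "k \<ge> Suc N" for k
      proof -
        obtain j where j: "k = Suc j" "j \<ge> N" using \<open>k \<ge> Suc N\<close> by (metis Suc_le_D Suc_le_mono)
        have "{p \<in> S. (f ^^ m k) p \<in> B j} \<subseteq> {p \<in> S. (f ^^ m k) p \<in> W}" using N[OF j(2)] by blast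
        moreover have "c \<in> connected_component_set {p \<in> S. (f ^^ m k) p \<in> B j} (x (m k))"
          using s(5)[of j] unfolding xm by (simp add: j(1) m_def y_def)
        ultimately show ?thesis by (rule connected_component_set_mono_mem)
      qed
      then show ?thesis unfolding eventually_sequentially by blast
    qed
    then show "\<forall>W. open W \<and> z \<in> W \<longrightarrow>
       (\<forall>\<^sub>F k in sequentially. c \<in> connected_component_set {p \<in> S. (f ^^ m k) p \<in> W} (x (m k)))"
      by simp
  qed
qed

section \<open>Signatures and the invariant lift\<close>

text \<open>
  Equivalent to a non-trivial signature if \<open>x\<close> has one, but meaningful also if \<open>x\<close> lies in no plaque.
\<close>

definition captures_along :: "riemann_sphere set \<Rightarrow> (riemann_sphere \<Rightarrow> riemann_sphere) \<Rightarrow> nat \<Rightarrow>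
    (nat \<Rightarrow> riemann_sphere) \<Rightarrow> riemann_sphere \<Rightarrow> nat set \<Rightarrow> bool" where
  "captures_along S f d x c M \<longleftrightarrow> infinite M \<and>
     (\<forall>U. plaque S f d U \<and> x \<in> plaque_points S f U \<longrightarrow> finite {n \<in> M. c \<notin> U n})"

lemma binary_class_le_ind_iff: "binary_class (\<lambda>n. n \<in> M) \<le> ind U c \<longleftrightarrow> finite {n \<in> M. c \<notin> U n}"
  by (simp add: ind_def less_eq_binary_class.abs_eq)

lemma binary_class_eq_bot_iff: "binary_class (\<lambda>n. n \<in> M) = bot \<longleftrightarrow> finite M"
  by (simp add: bot_binary_class.abs_eq binary_class.abs_eq_iff almost_equal_def)

text \<open>The class of the indicator of \<open>M\<close> lies below every
  \<open>ind (U j) c\<close>, and is not \<open>bot\<close> because \<open>M\<close> is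
  infinite.\<close>

lemma captures_along_signature:
  assumes M: "captures_along S f d x c M" and \<sigma>: "is_signature S f d x c \<sigma>"
  shows "{bot} \<subset> \<sigma>"
proof -
  obtain U where U: "shrinks_to S f d U x" "\<sigma> = (\<Inter>j. {b. b \<le> ind (U j) c})"
    using \<sigma> by (auto simp: is_signature_def)
  have "binary_class (\<lambda>n. n \<in> M) \<in> \<sigma>"
    using M U(1) unfolding U(2) captures_along_def shrinks_to_def
    by (simp add: binary_class_le_ind_iff)
  moreover have "binary_class (\<lambda>n. n \<in> M) \<noteq> bot"
    using M by (simp add: binary_class_eq_bot_iff captures_along_def)
  moreover have "bot \<in> \<sigma>" by (simp add: U(2))
  ultimately show ?thesis by blast
qed

text \<open>\<open>M\<close> is the support of a representative of a non-zero class in \<sigma>, and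
  every plaque around \<open>x\<close> contains some \<open>U j\<close> memberwise. A plaque is
  returned too, since capturing is vacuous for a point in no plaque.\<close>

lemma signature_captures_along:
  assumes \<sigma>: "is_signature S f d x c \<sigma>" "{bot} \<subset> \<sigma>"
  obtains U M where "plaque S f d U" "x \<in> plaque_points S f U" "captures_along S f d x c M"
proof -
  obtain U where U: "shrinks_to S f d U x" "\<sigma> = (\<Inter>j. {b. b \<le> ind (U j) c})"
    using \<sigma> by (auto simp: is_signature_def)
  obtain b where b: "b \<in> \<sigma>" "b \<noteq> bot" using \<sigma>(2) by blast
  define M where "M = {n. rep_binary_class b n}"
  have bM: "b = binary_class (\<lambda>n. n \<in> M)"
    using Quotient3_abs_rep[OF Quotient3_binary_class, of b] by (simp add: M_def)
  have "infinite M" using b(2) binary_class_eq_bot_iff[of M] bM by simp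
  moreover have "finite {n \<in> M. c \<notin> W n}" if W: "plaque S f d W" "x \<in> plaque_points S f W" for W
  proof -
    obtain j where j: "plaque S f d (U j)" "plaque_points S f (U j) \<subseteq> plaque_points S f W"
      using U(1) W unfolding shrinks_to_def by metis
    have "binary_class (\<lambda>n. n \<in> M) \<le> ind (U j) c" using b(1) bM U(2) by auto
    then have "finite {n \<in> M. c \<notin> U j n}" by (simp add: binary_class_le_ind_iff)
    moreover have "{n \<in> M. c \<notin> W n} \<subseteq> {n \<in> M. c \<notin> U j n}" using plaque_points_subsetD[OF j] by blast
    ultimately show ?thesis by (rule rev_finite_subset)
  qed
  ultimately have "captures_along S f d x c M" by (simp add: captures_along_def)
  moreover have "plaque S f d (U 0)" "x \<in> plaque_points S f (U 0)" using U(1) by (auto simp: shrinks_to_def)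
  ultimately show thesis using that by blast
qed

lemma captures_along_unbounded:
  assumes "captures_along S f d x c M" "plaque S f d U" "x \<in> plaque_points S f U"
  obtains n where "n > k" "c \<in> U n"
proof -
  have "infinite (M - {n \<in> M. c \<notin> U n})"
    using assms unfolding captures_along_def by (metis Diff_infinite_finite)
  then obtain n where "n > k" "n \<in> M - {n \<in> M. c \<notin> U n}" by (meson infinite_nat_iff_unbounded)
  then show thesis using that by blast
qed

text \<open>Regularity makes \<open>f\<close> injective on all late members, but arbitrarily late
  members contain the critical point. Injectivity at stage \<open>i\<close> concerns the member
  \<open>U (Suc i)\<close>, hence \<open>k = Suc i\<close>.\<close>

lemma captures_along_not_regular:
  assumes M: "captures_along S f d x c M" and f: "sphere_holomorphic_on f S" and c: "critical_point f c"
  shows "\<not> regular_point S f d x"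
proof
  assume "regular_point S f d x"
  then obtain U n where U: "plaque S f d U" "x \<in> plaque_points S f U"
    and n: "\<And>i. i \<ge> n \<Longrightarrow> bij_betw f (U (Suc i)) (U i)"
    by (auto simp: regular_point_def)
  obtain k where k: "k > n" "c \<in> U k" using captures_along_unbounded[OF M U] by metis
  then obtain i where i: "k = Suc i" "i \<ge> n" by (metis Suc_le_D Suc_le_eq Suc_le_mono)
  have "inj_on f (U k)" using n[OF i(2)] i(1) by (simp add: bij_betw_def)
  then show False
    using critical_point_not_injective[OF f plaqueD(1)[OF U(1)] k(2) plaqueD(2)[OF U(1)]] c by blast
qed

lemma inverse_critical_range:
  assumes S: "continuous_on S f" "f ` S \<subseteq> S" and fin: "\<And>q. q \<in> S \<Longrightarrow> finite {p \<in> S. f p = q}"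
    and M: "captures_along S f d x c M" and U: "plaque S f d U" "x \<in> plaque_points S f U"
  shows "inverse_critical S f c (range x)"
proof -
  have small: "\<exists>P. plaque S f d P \<and> x \<in> plaque_points S f P \<and> P i \<subseteq> W" if W: "open W" "x i \<in> W" for W i
    using plaque_refine_at[OF U W S finite_fibre_funpow[OF S(2) fin plaque_pointsD(3)[OF U(2)]]] by metis
  have descend: "(f ^^ (n - i)) (x n) = x i" if "i \<le> n" for i n
    using inverse_limit_funpow[OF plaque_pointsD(4)[OF U(2)], of "n - i" i] that by simp
  have img: "(f ^^ (n - i)) ` P n = P i" if "plaque S f d P" "i \<le> n" for P i n
    using plaque_funpow_image[OF that(1), of "n - i" i] that(2) by simp
  have "x i \<in> omega_limit S f c" for i
  proof (rule omega_limitI)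
    show "x i \<in> S" using plaque_pointsD(3)[OF U(2)] .
    fix W assume W: "open W" "x i \<in> W"
    obtain P where P: "plaque S f d P" "x \<in> plaque_points S f P" "P i \<subseteq> W"
      using small[OF W] by metis
    have "\<exists>n>k. (f ^^ n) c \<in> W" for k
    proof -
      \<comment> \<open>The bound is chosen so that the return time \<open>n - i\<close> to
        \<open>P i\<close> exceeds \<open>k\<close>.\<close>
      obtain n where n: "n > i + k" "c \<in> P n" using captures_along_unbounded[OF M P(1,2)] by metis
      then have "(f ^^ (n - i)) c \<in> P i" using img[OF P(1), of i n] by auto
      then show ?thesis using n(1) P(3) by (intro exI[of _ "n - i"]) auto
    qed
    then show "infinite {n. (f ^^ n) c \<in> W}" by (simp add: infinite_nat_iff_unbounded)
  qed
  moreover have "\<exists>n\<ge>1. \<exists>y\<in>range x. (f ^^ n) y = x i \<and> c \<in> connected_component_set {p \<in> S. (f ^^ n) p \<in> W} y"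
    if W: "open W" "x i \<in> W" for i W
  proof -
    obtain P where P: "plaque S f d P" "x \<in> plaque_points S f P" "P i \<subseteq> W"
      using small[OF W] by metis
    obtain n where n: "n > i" "c \<in> P n" using captures_along_unbounded[OF M P(1,2)] by metis
    have sub: "P n \<subseteq> {p \<in> S. (f ^^ (n - i)) p \<in> W}"
      using img[OF P(1), of i n] n(1) P(3) plaqueD(2)[OF P(1), of n] by auto
    have "c \<in> connected_component_set {p \<in> S. (f ^^ (n - i)) p \<in> W} (x n)"
      using connected_component_maximal[OF plaque_pointsD(1)[OF P(2)] connected_plaque[OF P(1)] sub] n(2)
      by (rule subsetD)
    then show ?thesis using n(1) descend[of i n] by (intro exI[of _ "n - i"] conjI bexI[of _ "x n"]) auto
  qed
  ultimately show ?thesis unfolding inverse_critical_def by blast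
qed

text \<open>Keeps \<open>x\<close> up to index \<open>n\<close> and grafts on a backward orbit
  starting at \<open>x n\<close>. All components are then taken over \<open>U n\<close>, and the
  captured indices are \<open>n + m k\<close>.\<close>

lemma invariant_lift_captures_along:
  assumes S: "open S" "continuous_on S f" "f ` S \<subseteq> S"
    and x: "x \<in> invariant_lift S f (Gamma_set S f c)"
  obtains y M where "y \<in> invariant_lift S f (Gamma_set S f c)" "\<And>i. i \<le> n \<Longrightarrow> y i = x i"
    "captures_along S f d y c M"
proof -
  let ?G = "Gamma_set S f c"
  have xn: "x n \<in> ?G" using x by (simp add: invariant_lift_def)
  obtain w m where w: "w \<in> invariant_lift S f ?G" "w 0 = x n" and m: "strict_mono m"
    and comp: "\<forall>W. open W \<and> x n \<in> W \<longrightarrow>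
       (\<forall>\<^sub>F k in sequentially. c \<in> connected_component_set {p \<in> S. (f ^^ m k) p \<in> W} (w (m k)))"
    by (rule Gamma_set_backward_orbit[OF S xn])
  define y where "y i = (if i \<le> n then x i else w (i - n))" for i
  have yn: "y (n + k) = w k" for k using w(2) by (cases k) (auto simp: y_def)
  have "y i \<in> ?G" for i using x w(1) by (simp add: y_def invariant_lift_def)
  moreover have "f (y (Suc i)) = y i" for i
  proof (cases "Suc i \<le> n")
    case True
    then show ?thesis using x by (simp add: y_def invariant_lift_def inverse_limit_def)
  next
    case False
    then obtain k where k: "i = n + k" using le_Suc_ex[of n i] by auto
    then have "Suc i = n + Suc k" by simp
    then show ?thesis using w(1) yn k by (simp only: yn) (simp add: invariant_lift_def inverse_limit_def)
  qed
  ultimately have y: "y \<in> invariant_lift S f ?G"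
    using subsetD[OF Gamma_set_subset[of S f c]] by (simp add: invariant_lift_def inverse_limit_def)
  have "captures_along S f d y c (range (\<lambda>k. n + m k))"
    unfolding captures_along_def
  proof (intro conjI allI impI)
    have "inj (\<lambda>k. n + m k)" using strict_mono_imp_inj_on[OF m, of UNIV] by (simp add: inj_on_def)
    then show "infinite (range (\<lambda>k. n + m k))" by (rule range_inj_infinite)
    fix U assume "plaque S f d U \<and> y \<in> plaque_points S f U"
    then have U: "plaque S f d U" "y \<in> plaque_points S f U" by auto
    have "x n \<in> U n" using plaque_pointsD(1)[OF U(2), of n] by (simp add: y_def)
    then have "\<forall>\<^sub>F k in sequentially. c \<in> connected_component_set {p \<in> S. (f ^^ m k) p \<in> U n} (w (m k))"
      using comp plaqueD(1)[OF U(1)] by blast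
    then obtain K where K: "\<And>k. k \<ge> K \<Longrightarrow> c \<in> connected_component_set {p \<in> S. (f ^^ m k) p \<in> U n} (w (m k))"
      unfolding eventually_sequentially by blast
    have "c \<in> U (n + m k)" if "k \<ge> K" for k
    proof -
      let ?C = "connected_component_set {p \<in> S. (f ^^ m k) p \<in> U n} (w (m k))"
      have sub: "?C \<subseteq> {p \<in> S. (f ^^ m k) p \<in> U n}" by (rule connected_component_subset)
      \<comment> \<open>A component that contains \<open>c\<close> is non-empty, so its base point
        belongs to the underlying set.\<close>
      have "w (m k) \<in> ?C" using K[OF that] connected_component_in connected_component_refl by fastforce
      then have "?C \<subseteq> U (n + m k)"
        using plaque_connected_subset[OF U(1) S U(2), of ?C n "m k"] sub yn by auto
      then show ?thesis using K[OF that] by blast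
    qed
    then have "{i \<in> range (\<lambda>k. n + m k). c \<notin> U i} \<subseteq> (\<lambda>k. n + m k) ` {k. \<not> K \<le> k}"
      by blast
    moreover have "finite ((\<lambda>k. n + m k) ` {k. \<not> K \<le> k})" by (simp add: not_le)
    ultimately show "finite {i \<in> range (\<lambda>k. n + m k). c \<notin> U i}" by (rule finite_subset)
  qed
  then show thesis using that[of y] y by (simp add: y_def)
qed

text \<open>The last two conjuncts replace the equality of sets, since the invariant lift can
  contain regular points: one inclusion holds, and conversely any initial segment of a point of the
  lift continues to an irregular point of the lift whose signature, if it has one, is
  non-trivial.\<close>

theorem theorem26:
  fixes S :: "riemann_sphere set" and f :: "riemann_sphere \<Rightarrow> riemann_sphere"
    and d :: nat and c :: riemann_sphere
  assumes "S = unit_disk \<or> S = complex_plane \<or> S = UNIV"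
    and "branched_covering S f d" and "1 < d"
    and "c \<in> S" and "critical_point f c"
  shows "(\<forall>x \<in> inverse_limit S f. \<forall>\<sigma>.
            is_signature S f d x c \<sigma> \<and> {bot} \<subset> \<sigma> \<longrightarrow> (\<forall>i. x i \<in> Gamma_set S f c))
       \<and> (\<forall>z \<in> Gamma_set S f c. \<exists>x \<in> inverse_limit S f. x 0 = z \<and>
            (\<forall>\<sigma>. is_signature S f d x c \<sigma> \<longrightarrow> {bot} \<subset> \<sigma>))
       \<and> {x \<in> inverse_limit S f. \<not> regular_point S f d x \<and>
            (\<exists>\<sigma>. is_signature S f d x c \<sigma> \<and> \<sigma> \<noteq> {bot})}
          \<subseteq> invariant_lift S f (Gamma_set S f c)
       \<and> (\<forall>x \<in> invariant_lift S f (Gamma_set S f c). \<forall>n.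
            \<exists>y \<in> invariant_lift S f (Gamma_set S f c). (\<forall>i\<le>n. y i = x i) \<and>
              \<not> regular_point S f d y \<and>
              (\<forall>\<sigma>. is_signature S f d y c \<sigma> \<longrightarrow> \<sigma> \<noteq> {bot}))"
proof -
  let ?G = "Gamma_set S f c"
  have "open complex_plane" unfolding complex_plane_def by (rule open_Fin_image) simp
  then have oS: "open S" using assms(1) open_unit_disk by auto
  have hol: "sphere_holomorphic_on f S" and fS: "f ` S \<subseteq> S"
    and fin: "\<And>q. q \<in> S \<Longrightarrow> finite {p \<in> S. f p = q}"
    using assms(2) by (auto simp: branched_covering_def)
  have cont: "continuous_on S f" using hol by (simp add: sphere_holomorphic_on_def)
  have 1: "x i \<in> ?G" if sig: "is_signature S f d x c \<sigma>" "{bot} \<subset> \<sigma>" for x \<sigma> i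
  proof -
    obtain U M where "plaque S f d U" "x \<in> plaque_points S f U" "captures_along S f d x c M"
      using signature_captures_along[OF sig] by metis
    then have "inverse_critical S f c (range x)" using inverse_critical_range[OF cont fS fin] by metis
    then show ?thesis unfolding Gamma_set_def by blast
  qed
  have 2: "\<exists>x\<in>inverse_limit S f. x 0 = z \<and> (\<forall>\<sigma>. is_signature S f d x c \<sigma> \<longrightarrow> {bot} \<subset> \<sigma>)"
    if z: "z \<in> ?G" for z
  proof -
    \<comment> \<open>Any point of the lift over \<open>z\<close> will do here; the construction
      with \<open>n = 0\<close> retains just its coordinate \<open>w 0\<close>.\<close>
    obtain w where w: "w \<in> invariant_lift S f ?G" "w 0 = z"
      by (rule Gamma_set_backward_orbit[OF oS cont fS z])
    obtain y M where y: "y \<in> invariant_lift S f ?G" "\<And>i. i \<le> 0 \<Longrightarrow> y i = w i" "captures_along S f d y c M"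
      using invariant_lift_captures_along[OF oS cont fS w(1), of 0 d] by metis
    have "y \<in> inverse_limit S f" "y 0 = z" using y(1,2) w(2) by (auto simp: invariant_lift_def)
    then show ?thesis using captures_along_signature[OF y(3)] by blast
  qed
  have 3: "x \<in> invariant_lift S f ?G"
    if x: "x \<in> inverse_limit S f" "is_signature S f d x c \<sigma>" "\<sigma> \<noteq> {bot}" for x \<sigma>
  proof -
    have "bot \<in> \<sigma>" using x(2) by (auto simp: is_signature_def)
    then have "{bot} \<subset> \<sigma>" using x(3) by blast
    then show ?thesis using 1[OF x(2)] x(1) by (simp add: invariant_lift_def)
  qed
  have 4: "\<exists>y\<in>invariant_lift S f ?G. (\<forall>i\<le>n. y i = x i) \<and> \<not> regular_point S f d y \<and>
      (\<forall>\<sigma>. is_signature S f d y c \<sigma> \<longrightarrow> \<sigma> \<noteq> {bot})"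
    if x: "x \<in> invariant_lift S f ?G" for x n
  proof -
    obtain y M where y: "y \<in> invariant_lift S f ?G" "\<And>i. i \<le> n \<Longrightarrow> y i = x i" "captures_along S f d y c M"
      using invariant_lift_captures_along[OF oS cont fS x, of n d] by metis
    have "\<not> regular_point S f d y" using captures_along_not_regular[OF y(3) hol assms(5)] .
    moreover have "\<sigma> \<noteq> {bot}" if "is_signature S f d y c \<sigma>" for \<sigma>
      using captures_along_signature[OF y(3) that] by blast
    ultimately show ?thesis using y(1,2) by blast
  qed
  show ?thesis
  proof (intro conjI)
    show "\<forall>x\<in>inverse_limit S f. \<forall>\<sigma>. is_signature S f d x c \<sigma> \<and> {bot} \<subset> \<sigma> \<longrightarrow> (\<forall>i. x i \<in> ?G)"
      using 1 by (intro ballI allI impI) (elim conjE)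
    show "{x \<in> inverse_limit S f. \<not> regular_point S f d x \<and>
        (\<exists>\<sigma>. is_signature S f d x c \<sigma> \<and> \<sigma> \<noteq> {bot})} \<subseteq> invariant_lift S f ?G"
      using 3 by (intro subsetI) (elim CollectE conjE exE)
  qed (intro ballI allI 2 4, assumption)+
qed

end
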